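(* Consider a time-homogeneous, translation-invariant skip-free process on $\mathbb{Z}$; let $P_s(n)$ denote its transition probability from $0$ to $n$ in time $s$, and suppose the process is symmetric: $P_s(n)=P_s(-n)$. Run the corresponding coalescing system, started with every site of $\mathbb{Z}$ occupied, up to a fixed time $T>0$. Then the gap intensity measure $\mu$ of the surviving particles at time $T$ is $$\mu(\{g\})=P_{2T}(g-1)-P_{2T}(g+1),\qquad g=1,2,3,\dots$$ The total intensity is $$\sum_{g=1}^{\infty}\mu(\{g\})=P_{2T}(0)+P_{2T}(1),$$ which is the survivor density per site (the probability that a given site is occupied by a survivor at time $T$). Dividing by the total intensity recovers the gap probability mass function: $$\mathbb{P}(G=g)=\frac{P_{2T}(g-1)-P_{2T}(g+1)}{P_{2T}(0)+P_{2T}(1)},\qquad g=1,2,3,\dots$$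
   Context: Skip-free process on $\mathbb{Z}$: a Markov process on $\mathbb{Z}$ satisfying the Karlin–McGregor assumptions, i.e. its transitions are only to neighbouring states, so that two independent copies started from distinct occupied sites cannot change their order without first being at the same site at the same time. Translation-invariant: the probability of going from $x$ to $y$ in time $s$ is $P_s(y-x)$. Coalescing system with every site occupied: one particle starts at each $x\in\mathbb{Z}$; distinct particles move independently as copies of the process until they meet; when particles meet they merge and continue as one. (The infinite system is consistent: restricted to any finite set of starting sites it has the law of the coalescing system started from that finite set alone.) Survivors are the distinct positions occupied at time $T$. A gap is the difference $y_1-y_0$ of two consecutive survivors $y_0<y_1$ (survivors with no survivor strictly between them). The gap intensity measure: $\mu(\{g\})$ is the expected number of gaps of size $g$ per unit length, i.e. (by translation invariance, for any fixed $y_0\in\mathbb{Z}$) the probability that $y_0$ and $y_0+g$ are consecutive survivors. The gap probability distribution (law of $G$) is $\mu$ normalized to total mass $1$. *)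

theory Defs
  imports "HOL-Probability.Probability"
begin

text \<open>
  Paths are functions of real time and only their values at times \<open>t \<ge> 0\<close> matter.  The type of
  integers carries the discrete topology, so a right-continuous path with left limits is a step
  function; the last clause says that each of its jumps leads to a neighbouring state.
\<close>

definition skip_free_path :: "(real \<Rightarrow> int) \<Rightarrow> bool" where
  "skip_free_path f \<longleftrightarrow>
     (\<forall>t\<ge>0. continuous (at_right t) f) \<and>
     (\<forall>t>0. \<exists>l. (f \<longlongrightarrow> l) (at_left t) \<and> \<bar>f t - l\<bar> \<le> 1)"

definition past_events :: "'b measure \<Rightarrow> (real \<Rightarrow> 'b \<Rightarrow> int) \<Rightarrow> real \<Rightarrow> 'b set set" where
  "past_events N Z s = sigma_sets (space N) {Z u -` B \<inter> space N |u B. u \<in> {0..s}}"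

text \<open>
  A time-homogeneous Markov process on the integers with skip-free paths, given as a Markov family:
  \<open>N x\<close> is the probability space of the process started from \<open>x\<close>, and \<open>p s x y\<close> is the probability of
  going from \<open>x\<close> to \<open>y\<close> in time \<open>s\<close>.  (That two independent copies almost surely do not exchange
  their order without meeting is a consequence and not part of the definition.)
\<close>

definition skip_free_process ::
  "(int \<Rightarrow> 'b measure) \<Rightarrow> (real \<Rightarrow> 'b \<Rightarrow> int) \<Rightarrow> (real \<Rightarrow> int \<Rightarrow> int \<Rightarrow> real) \<Rightarrow> bool" where
  "skip_free_process N Z p \<longleftrightarrow>
     (\<forall>x. prob_space (N x) \<and>
        (\<forall>t\<ge>0. Z t \<in> N x \<rightarrow>\<^sub>M count_space UNIV) \<and>
        (\<forall>\<omega>\<in>space (N x). skip_free_path (\<lambda>t. Z t \<omega>)) \<and>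
        (AE \<omega> in N x. Z 0 \<omega> = x) \<and>
        (\<forall>s\<ge>0. \<forall>t\<ge>0. \<forall>A\<in>past_events (N x) Z s. \<forall>y z.
           measure (N x) {\<omega>\<in>A. Z s \<omega> = y \<and> Z (s + t) \<omega> = z} =
           measure (N x) {\<omega>\<in>A. Z s \<omega> = y} * p t y z))"

text \<open>
  The particle with own path \<open>g\<close> is added to a system of particles with paths \<open>F b\<close>, \<open>b \<in> B\<close>: it
  follows \<open>g\<close> until the first time it meets one of them, and that particle from then on.  For
  right-continuous paths the infimum \<open>Inf S\<close> is attained, so it is the first meeting time.  If several
  particles are met there, they have already merged, so it does not matter that \<open>Min\<close> is chosen.
\<close>

definition attach ::
  "int set \<Rightarrow> (int \<Rightarrow> real \<Rightarrow> int) \<Rightarrow> (real \<Rightarrow> int) \<Rightarrow> real \<Rightarrow> int" where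
  "attach B F g t =
     (let S = {s \<in> {0..t}. \<exists>b\<in>B. F b s = g s}
      in if S = {} then g t else F (Min {b \<in> B. F b (Inf S) = g (Inf S)}) t)"

primrec coalesce :: "int list \<Rightarrow> (int \<Rightarrow> real \<Rightarrow> int) \<Rightarrow> int \<Rightarrow> real \<Rightarrow> int" where
  "coalesce [] w = w"
| "coalesce (x # xs) w =
     (let F = coalesce xs w in F(x := attach (set xs) F (w x)))"

text \<open>
  The law, as a probability measure on families of paths, of the coalescing system started from
  the finite set \<open>A\<close>.  The measure \<open>PiM A N\<close> provides independent copies of the process, one for each
  starting site.  Which of the particles that meet is the one to be followed (here the one with the
  larger starting site) does not affect the law.
\<close>

definition finite_coalescing_law ::
  "(int \<Rightarrow> 'b measure) \<Rightarrow> (real \<Rightarrow> 'b \<Rightarrow> int) \<Rightarrow> int set \<Rightarrow> (int \<times> real \<Rightarrow> int) measure" where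
  "finite_coalescing_law N Z A =
     distr (PiM A N) (PiM (A \<times> {0..}) (\<lambda>_. count_space UNIV))
       (\<lambda>\<omega>. \<lambda>(x, t)\<in>A \<times> {0..}. coalesce (sorted_list_of_set A) (\<lambda>a s. Z s (\<omega> a)) x t)"

text \<open>
  \<open>X x t\<close> is the position at time \<open>t\<close> of the particle started at \<open>x\<close>, with one particle for every
  integer \<open>x\<close>.  The infinite system is specified by its restrictions to finite sets of
  starting sites.
\<close>

definition coalescing_system ::
  "(int \<Rightarrow> 'b measure) \<Rightarrow> (real \<Rightarrow> 'b \<Rightarrow> int) \<Rightarrow> 'a measure \<Rightarrow> (int \<Rightarrow> real \<Rightarrow> 'a \<Rightarrow> int) \<Rightarrow> bool" where
  "coalescing_system N Z M X \<longleftrightarrow>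
     prob_space M \<and>
     (\<forall>x. \<forall>t\<ge>0. X x t \<in> M \<rightarrow>\<^sub>M count_space UNIV) \<and>
     (\<forall>A. finite A \<longrightarrow>
        distr M (PiM (A \<times> {0..}) (\<lambda>_. count_space UNIV)) (\<lambda>\<omega>. \<lambda>(x, t)\<in>A \<times> {0..}. X x t \<omega>) =
        finite_coalescing_law N Z A)"

definition survivors :: "(int \<Rightarrow> real \<Rightarrow> 'a \<Rightarrow> int) \<Rightarrow> real \<Rightarrow> 'a \<Rightarrow> int set" where
  "survivors X T \<omega> = range (\<lambda>x. X x T \<omega>)"

definition consecutive :: "int set \<Rightarrow> int \<Rightarrow> int \<Rightarrow> bool" where
  "consecutive S y\<^sub>0 y\<^sub>1 \<longleftrightarrow> y\<^sub>0 \<in> S \<and> y\<^sub>1 \<in> S \<and> y\<^sub>0 < y\<^sub>1 \<and> S \<inter> {y\<^sub>0<..<y\<^sub>1} = {}"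

text \<open>
  The gap intensity per site, as seen from the site \<open>y\<^sub>0\<close>; by translation invariance it is the
  same for every \<open>y\<^sub>0\<close>.
\<close>

definition gap_intensity ::
  "'a measure \<Rightarrow> (int \<Rightarrow> real \<Rightarrow> 'a \<Rightarrow> int) \<Rightarrow> real \<Rightarrow> int \<Rightarrow> int measure" where
  "gap_intensity M X T y\<^sub>0 =
     point_measure {1..}
       (\<lambda>g. emeasure M {\<omega>\<in>space M. consecutive (survivors X T \<omega>) y\<^sub>0 (y\<^sub>0 + g)})"

definition gap_law ::
  "'a measure \<Rightarrow> (int \<Rightarrow> real \<Rightarrow> 'a \<Rightarrow> int) \<Rightarrow> real \<Rightarrow> int \<Rightarrow> int measure" where
  "gap_law M X T y\<^sub>0 =
     (let \<mu> = gap_intensity M X T y\<^sub>0 in scale_measure (1 / emeasure \<mu> (space \<mu>)) \<mu>)"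

end

theory Submission imports Defs begin

text \<open>
  Particles started at neighbouring sites determine the gaps.  Almost surely the map
  \<open>x \<mapsto> X x T\<close> is nondecreasing, so \<open>y\<close> and \<open>y + g\<close> are consecutive survivors if and only if
  there is a site \<open>x\<close> with \<open>X x T = y\<close> and \<open>X (x + 1) T = y + g\<close> (\<open>consecutive_range_iff\<close>),
  and this \<open>x\<close> is unique.  The gap probability is therefore the sum over \<open>x\<close> of
  the probabilities of these events.

  Each such event involves only two particles that have not merged, hence two independent copies of
  the process that have not met.  By the Karlin--McGregor formula (\<open>karlin_mcgregor\<close>,
  \<open>neighbours_law\<close>) its probability is
  \<open>P T (y - x) * P T (y + g - x - 1) - P T (y + g - x) * P T (y - x - 1)\<close>.
  By the symmetry of \<open>P\<close>, summing each product over \<open>x\<close> is a Chapman--Kolmogorov convolution,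
  and the two sums are \<open>P (2 * T) (g - 1)\<close> and \<open>P (2 * T) (g + 1)\<close> (\<open>gap_probability\<close>).

  The Karlin--McGregor formula has two ingredients.  The first is reflection: exchanging the two
  copies after their first meeting preserves the law, so among the paths that meet, those that end at
  \<open>(a, b)\<close> are as likely as those that end at \<open>(b, a)\<close>.  Restricted to meetings in a finite set of
  times this needs only the Markov property at fixed times (\<open>reflection_finite\<close>); right-continuity
  gives the passage to all times (\<open>reflection\<close>).  The second is that paths which do not meet keep
  their order.  Since jumps have size at most one, a change of order without a meeting requires a
  simultaneous jump of both copies.  A path has countably many jumps and
  the other copy almost surely does not jump at any given time, so by Fubini there is no
  simultaneous jump (\<open>AE_no_crossing\<close>).

  A survivor almost surely has a next survivor above it, because otherwise the position would be
  constant in \<open>x\<close> from some site on, whereas \<open>P T (y - x)\<close> tends to \<open>0\<close>.  Hence the gap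
  intensities sum to the probability of occupation, and the sum telescopes to
  \<open>P (2 * T) 0 + P (2 * T) 1\<close>.
\<close>

section \<open>Integer-valued right-continuous paths\<close>

lemma skip_free_path_constant_right:
  assumes "skip_free_path f" "0 \<le> t"
  obtains e where "0 < e" "\<And>s. t \<le> s \<Longrightarrow> s < t + e \<Longrightarrow> f s = f t"
proof -
  have "(f \<longlongrightarrow> f t) (at_right t)"
    using assms unfolding skip_free_path_def continuous_within by blast
  then have "eventually (\<lambda>s. f s = f t) (at_right t)"
    by (simp add: tendsto_discrete)
  then obtain b where b: "b > t" "\<And>s. t < s \<Longrightarrow> s < b \<Longrightarrow> f s = f t"
    unfolding eventually_at_right_field by blast
  show thesis
    by (rule that[of "b - t"]) (use b in \<open>auto simp: le_less\<close>)
qed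

text \<open>
  A right-continuous integer-valued path is constant on a short interval to the right of any time.
  Hence a relation between two such paths that holds at times decreasing to some time
  also holds at that time.
\<close>

lemma first_time_attained:
  assumes f: "skip_free_path f" and g: "skip_free_path g"
    and ne: "{s \<in> {0..t}. R (f s) (g s)} \<noteq> {}"
  shows "Inf {s \<in> {0..t}. R (f s) (g s)} \<in> {s \<in> {0..t}. R (f s) (g s)}"
proof -
  define S where "S = {s \<in> {0..t}. R (f s) (g s)}"
  have bdd: "bdd_below S" by (auto simp: S_def intro: bdd_belowI[of _ 0])
  have S: "S \<noteq> {}" using ne by (simp add: S_def)
  then obtain s0 where "s0 \<in> S" by blast
  then have "Inf S \<le> t" using cInf_lower[OF _ bdd, of s0] by (auto simp: S_def)
  moreover have pos: "0 \<le> Inf S" using S by (intro cInf_greatest) (auto simp: S_def)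
  moreover have "R (f (Inf S)) (g (Inf S))"
  proof -
    obtain d where d: "0 < d" "\<And>s. Inf S \<le> s \<Longrightarrow> s < Inf S + d \<Longrightarrow> f s = f (Inf S)"
      using skip_free_path_constant_right[OF f pos] by metis
    obtain e where e: "0 < e" "\<And>s. Inf S \<le> s \<Longrightarrow> s < Inf S + e \<Longrightarrow> g s = g (Inf S)"
      using skip_free_path_constant_right[OF g pos] by metis
    have "Inf S < Inf S + min d e" using d(1) e(1) by simp
    then obtain s where s: "s \<in> S" "s < Inf S + min d e"
      using cInf_lessD[OF S] by blast
    then have "Inf S \<le> s" using cInf_lower[OF _ bdd] by blast
    then show ?thesis using d(2)[of s] e(2)[of s] s by (auto simp: S_def)
  qed
  ultimately show ?thesis by (simp add: S_def)
qed

text \<open>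
  A countable set of times in which every meeting up to \<open>T\<close> is detected: a meeting
  before \<open>T\<close> persists for a short while, hence until some rational time, whereas
  a meeting at \<open>T\<close> need not have any later time in the interval.
\<close>

definition sample_times :: "real \<Rightarrow> real set" where
  "sample_times T = insert T ({0..T} \<inter> \<rat>)"

lemma countable_sample_times: "countable (sample_times T)"
  by (auto simp: sample_times_def intro: countable_rat)

lemma sample_times_subset: "0 \<le> T \<Longrightarrow> sample_times T \<subseteq> {0..T}"
  by (auto simp: sample_times_def)

lemma meet_iff_sample_times:
  assumes f: "skip_free_path f" and g: "skip_free_path g" and T: "0 \<le> T"
  shows "(\<exists>s\<in>{0..T}. f s = g s) \<longleftrightarrow> (\<exists>s\<in>sample_times T. f s = g s)"
proof
  assume "\<exists>s\<in>{0..T}. f s = g s"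
  then obtain s where s: "0 \<le> s" "s \<le> T" "f s = g s" by auto
  show "\<exists>s\<in>sample_times T. f s = g s"
  proof (cases "s = T")
    case True
    then show ?thesis using s by (auto simp: sample_times_def)
  next
    case False
    obtain d where d: "0 < d" "\<And>u. s \<le> u \<Longrightarrow> u < s + d \<Longrightarrow> f u = f s"
      using skip_free_path_constant_right[OF f s(1)] by metis
    obtain e where e: "0 < e" "\<And>u. s \<le> u \<Longrightarrow> u < s + e \<Longrightarrow> g u = g s"
      using skip_free_path_constant_right[OF g s(1)] by metis
    have "s < min T (s + min d e)" using False s d(1) e(1) by simp
    then obtain q where "q \<in> \<rat>" "s < q" "q < min T (s + min d e)"
      using Rats_dense_in_real by blast
    then show ?thesis
      using d(2)[of q] e(2)[of q] s by (auto simp: sample_times_def intro!: bexI[of _ q])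
  qed
qed (use sample_times_subset[OF T] in blast)

definition jump_times :: "(real \<Rightarrow> int) \<Rightarrow> real set" where
  "jump_times f = {s. 0 < s \<and> \<not> (f \<longlongrightarrow> f s) (at_left s)}"

text \<open>
  Because left limits exist, a path is constant on some interval to the left of each jump.  A rational
  number chosen in this interval determines the jump.
\<close>

lemma countable_jump_times:
  assumes f: "skip_free_path f"
  shows "countable (jump_times f)"
proof -
  have "\<exists>q\<in>\<rat>. q < s \<and> (\<forall>r. q < r \<and> r < s \<longrightarrow> r \<notin> jump_times f)" if s: "s \<in> jump_times f" for s
  proof -
    obtain l where "(f \<longlongrightarrow> l) (at_left s)"
      using f s unfolding skip_free_path_def jump_times_def by blast
    then obtain b where b: "b < s" "\<And>r. b < r \<Longrightarrow> r < s \<Longrightarrow> f r = l"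
      unfolding tendsto_discrete eventually_at_left_field by blast
    obtain q where q: "q \<in> \<rat>" "b < q" "q < s" using Rats_dense_in_real[OF b(1)] by blast
    have "r \<notin> jump_times f" if r: "q < r" "r < s" for r
    proof -
      have "eventually (\<lambda>u. f u = f r) (at_left r)"
        unfolding eventually_at_left_field using b(2) q r
        by (intro exI[of _ q]) auto
      then show ?thesis by (simp add: jump_times_def tendsto_discrete)
    qed
    then show ?thesis using q by blast
  qed
  then obtain q where q: "\<And>s. s \<in> jump_times f \<Longrightarrow> q s \<in> \<rat> \<and> q s < s \<and>
      (\<forall>r. q s < r \<and> r < s \<longrightarrow> r \<notin> jump_times f)"
    by metis
  have "inj_on q (jump_times f)"
    proof (rule linorder_inj_onI)
    fix r s assume "r < s" "r \<in> jump_times f" "s \<in> jump_times f"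
    then show "q r \<noteq> q s" using q[of r] q[of s] by auto
  qed auto
  moreover have "q ` jump_times f \<subseteq> \<rat>" using q by blast
  ultimately show ?thesis
    using countable_rat countable_subset countable_image_inj_on by metis
qed

text \<open>
  At the first time of reversed order the difference of the two paths passes from at least \<open>1\<close> to
  at most \<open>-1\<close> without taking the value \<open>0\<close>.  It changes by at least two, and each path
  contributes at most one.
\<close>

lemma crossing_needs_simultaneous_jump:
  assumes f: "skip_free_path f" and g: "skip_free_path g"
    and start: "f 0 < g 0" and finish: "g T < f T" and T: "0 \<le> T"
    and apart: "\<And>s. s \<in> {0..T} \<Longrightarrow> f s \<noteq> g s"
  shows "jump_times f \<inter> jump_times g \<noteq> {}"
proof -
  define \<sigma> where "\<sigma> = Inf {s \<in> {0..T}. f s > g s}"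
  have "{s \<in> {0..T}. f s > g s} \<noteq> {}" using finish T by force
  from first_time_attained[OF f g this]
  have \<sigma>: "\<sigma> \<in> {0..T}" "f \<sigma> > g \<sigma>" by (auto simp: \<sigma>_def)
  have before: "f s < g s" if "0 \<le> s" "s < \<sigma>" for s
  proof (rule ccontr)
    assume "\<not> f s < g s"
    then have "s \<in> {s \<in> {0..T}. f s > g s}" using apart[of s] that \<sigma> by auto
    then have "\<sigma> \<le> s" unfolding \<sigma>_def by (rule cInf_lower) (auto intro: bdd_belowI[of _ 0])
    then show False using that by simp
  qed
  have pos: "0 < \<sigma>" using \<sigma> start by (cases "\<sigma> = 0") auto
  obtain l where l: "(f \<longlongrightarrow> l) (at_left \<sigma>)" "\<bar>f \<sigma> - l\<bar> \<le> 1"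
    using f pos unfolding skip_free_path_def by blast
  obtain m where m: "(g \<longlongrightarrow> m) (at_left \<sigma>)" "\<bar>g \<sigma> - m\<bar> \<le> 1"
    using g pos unfolding skip_free_path_def by blast
  have "eventually (\<lambda>s. f s = l \<and> g s = m \<and> 0 < s \<and> s < \<sigma>) (at_left \<sigma>)"
    using l(1)[unfolded tendsto_discrete] m(1)[unfolded tendsto_discrete]
      eventually_at_left_real[OF pos]
    by eventually_elim simp
  then obtain s where "f s = l" "g s = m" "0 < s" "s < \<sigma>"
    using eventually_happens'[OF trivial_limit_at_left_real] by blast
  then have "l < m" using before[of s] by simp
  then have "l \<noteq> f \<sigma>" "m \<noteq> g \<sigma>" using \<sigma> l(2) m(2) by linarith+
  then have "\<sigma> \<in> jump_times f \<inter> jump_times g"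
    using l(1) m(1) pos tendsto_unique[OF trivial_limit_at_left_real]
    by (auto simp: jump_times_def)
  then show ?thesis by blast
qed

section \<open>One translation-invariant skip-free process\<close>

lemma (in finite_measure) has_sum_measure_disjoint_int:
  fixes A :: "int \<Rightarrow> 'a set"
  assumes "\<And>i. A i \<in> sets M" "disjoint_family A"
  shows "((\<lambda>i. measure M (A i)) has_sum measure M (\<Union>i. A i)) UNIV"
proof -
  have bij: "bij_betw int_decode UNIV UNIV" by (rule bij_int_decode)
  have "disjoint_family (\<lambda>n. A (int_decode n))"
    using assms(2) by (auto simp: disjoint_family_on_def int_decode_eq)
  then have "(\<lambda>n. measure M (A (int_decode n))) sums measure M (\<Union>n. A (int_decode n))"
    using assms(1) by (intro finite_measure_UNION) auto
  also have "(\<Union>n. A (int_decode n)) = (\<Union>i. A i)"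
    using surj_int_decode by (metis image_image)
  finally have "((\<lambda>n. measure M (A (int_decode n))) has_sum measure M (\<Union>i. A i)) UNIV"
    by (rule sums_nonneg_imp_has_sum) simp
  then show ?thesis by (subst has_sum_reindex_bij_betw[OF bij, symmetric])
qed

locale translation_invariant_process =
  fixes N :: "int \<Rightarrow> 'b measure" and Z :: "real \<Rightarrow> 'b \<Rightarrow> int" and P :: "real \<Rightarrow> int \<Rightarrow> real"
  assumes process: "skip_free_process N Z (\<lambda>s x y. P s (y - x))"
begin

lemma prob_space_N: "prob_space (N x)"
  using process unfolding skip_free_process_def by blast

lemma measurable_Z [measurable]: "0 \<le> t \<Longrightarrow> Z t \<in> N x \<rightarrow>\<^sub>M count_space UNIV"
  using process unfolding skip_free_process_def by blast

lemma skip_free_Z: "\<omega> \<in> space (N x) \<Longrightarrow> skip_free_path (\<lambda>t. Z t \<omega>)"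
  using process unfolding skip_free_process_def by blast

lemma AE_start: "AE \<omega> in N x. Z 0 \<omega> = x"
  using process unfolding skip_free_process_def by blast

lemma markov:
  assumes "0 \<le> s" "0 \<le> t" "A \<in> past_events (N x) Z s"
  shows "measure (N x) {\<omega>\<in>A. Z s \<omega> = y \<and> Z (s + t) \<omega> = z} =
    measure (N x) {\<omega>\<in>A. Z s \<omega> = y} * P t (z - y)"
  using process assms unfolding skip_free_process_def by blast

sublocale process: prob_space "N x" for x by (rule prob_space_N)

sublocale pair: pair_prob_space "N x" "N x'" for x x' ..

sublocale sigma_past: sigma_algebra "space (N x)" "past_events (N x) Z s" for x s
  unfolding past_events_def by (rule sigma_algebra_sigma_sets) auto

lemma past_events_Z:
  assumes "0 \<le> u" "u \<le> s"
  shows "{\<omega>\<in>space (N x). Q (Z u \<omega>)} \<in> past_events (N x) Z s"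
proof -
  have "{\<omega>\<in>space (N x). Q (Z u \<omega>)} = Z u -` Collect Q \<inter> space (N x)" by auto
  then show ?thesis
    unfolding past_events_def using assms by (intro sigma_sets.Basic) (auto simp del: vimage_Collect_eq)
qed

lemma law_at: "0 \<le> s \<Longrightarrow> measure (N x) {\<omega>\<in>space (N x). Z s \<omega> = z} = P s (z - x)"
proof -
  assume s: "0 \<le> s"
  have "measure (N x) {\<omega>\<in>space (N x). Z s \<omega> = z} =
      measure (N x) {\<omega>\<in>space (N x). Z 0 \<omega> = x \<and> Z (0 + s) \<omega> = z}"
    using AE_start[of x] s by (intro process.finite_measure_eq_AE) auto
  also have "\<dots> = measure (N x) {\<omega>\<in>space (N x). Z 0 \<omega> = x} * P s (z - x)"
    using s by (intro markov) auto
  also have "measure (N x) {\<omega>\<in>space (N x). Z 0 \<omega> = x} = 1"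
    using AE_start by (intro process.prob_Collect_eq_1[THEN iffD2]) auto
  finally show ?thesis by simp
qed

lemma P_nonneg: "0 \<le> s \<Longrightarrow> 0 \<le> P s n"
  using law_at[of s 0 n] measure_nonneg[of "N 0" "{\<omega>\<in>space (N 0). Z s \<omega> = n}"] by simp

lemma P_has_sum_1: "0 \<le> s \<Longrightarrow> (P s has_sum 1) UNIV"
proof -
  assume s: "0 \<le> s"
  have "((\<lambda>y. measure (N 0) {\<omega>\<in>space (N 0). Z s \<omega> = y}) has_sum
      measure (N 0) (\<Union>y. {\<omega>\<in>space (N 0). Z s \<omega> = y})) UNIV"
    using s by (intro process.has_sum_measure_disjoint_int) (auto simp: disjoint_family_on_def)
  also have "(\<Union>y. {\<omega>\<in>space (N 0). Z s \<omega> = y}) = space (N 0)" by auto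
  finally show ?thesis using s by (simp add: law_at process.prob_space)
qed

lemma joint_law:
  assumes "0 \<le> s" "0 \<le> t"
  shows "measure (N x) {\<omega>\<in>space (N x). Z s \<omega> = y \<and> Z (s + t) \<omega> = z} = P s (y - x) * P t (z - y)"
  using markov[OF assms, of "space (N x)" x y z] assms by (simp add: law_at)

lemma chapman_kolmogorov:
  assumes "0 \<le> s" "0 \<le> t"
  shows "((\<lambda>y. P s y * P t (n - y)) has_sum P (s + t) n) UNIV"
proof -
  have "((\<lambda>y. measure (N 0) {\<omega>\<in>space (N 0). Z s \<omega> = y \<and> Z (s + t) \<omega> = n}) has_sum
      measure (N 0) (\<Union>y. {\<omega>\<in>space (N 0). Z s \<omega> = y \<and> Z (s + t) \<omega> = n})) UNIV"
    using assms by (intro process.has_sum_measure_disjoint_int) (auto simp: disjoint_family_on_def)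
  also have "(\<Union>y. {\<omega>\<in>space (N 0). Z s \<omega> = y \<and> Z (s + t) \<omega> = n}) =
      {\<omega>\<in>space (N 0). Z (s + t) \<omega> = n}" by auto
  finally show ?thesis using assms by (simp add: joint_law law_at)
qed

text \<open>
  By translation invariance the probability of standing still is the same for all positions at
  time \<open>s\<close>.
\<close>

lemma P_stay: "0 \<le> s \<Longrightarrow> 0 \<le> t \<Longrightarrow>
    measure (N x) {\<omega>\<in>space (N x). Z s \<omega> = Z (s + t) \<omega>} = P t 0"
proof -
  assume st: "0 \<le> s" "0 \<le> t"
  have "((\<lambda>y. measure (N x) {\<omega>\<in>space (N x). Z s \<omega> = y \<and> Z (s + t) \<omega> = y}) has_sum
      measure (N x) (\<Union>y. {\<omega>\<in>space (N x). Z s \<omega> = y \<and> Z (s + t) \<omega> = y})) UNIV"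
    using st by (intro process.has_sum_measure_disjoint_int) (auto simp: disjoint_family_on_def)
  also have "(\<Union>y. {\<omega>\<in>space (N x). Z s \<omega> = y \<and> Z (s + t) \<omega> = y}) =
      {\<omega>\<in>space (N x). Z s \<omega> = Z (s + t) \<omega>}" by auto
  finally have "((\<lambda>y. P s (y - x) * P t 0) has_sum
      measure (N x) {\<omega>\<in>space (N x). Z s \<omega> = Z (s + t) \<omega>}) UNIV"
    using st by (simp add: joint_law)
  moreover have "((\<lambda>y. P s (y - x) * P t 0) has_sum 1 * P t 0) UNIV"
  proof (rule has_sum_cmult_left)
    have "bij_betw (\<lambda>y. y - x) UNIV UNIV"
      by (rule bij_betw_byWitness[where f' = "\<lambda>y. y + x"]) auto
    from has_sum_reindex_bij_betw[OF this, of "P s"] P_has_sum_1[OF st(1)]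
    show "((\<lambda>y. P s (y - x)) has_sum 1) UNIV" by simp
  qed
  ultimately show ?thesis using has_sum_unique by fastforce
qed

lemma P_stay_tendsto_1:
  assumes "0 < s"
  shows "(\<lambda>n. P (s / real (Suc n)) 0) \<longlonglongrightarrow> 1"
proof -
  define h where "h n = s / real (Suc n)" for n
  have h0: "0 \<le> h n" for n using assms by (simp add: h_def)
  have h: "h \<longlonglongrightarrow> 0" unfolding h_def by (intro LIMSEQ_Suc lim_const_over_n)
  define A where "A k = {\<omega>\<in>space (N 0). \<forall>n\<ge>k. Z (h n) \<omega> = Z 0 \<omega>}" for k
  have A_meas: "A k \<in> sets (N 0)" for k 
  proof -
    have [measurable]: "Z (h n) \<in> N 0 \<rightarrow>\<^sub>M count_space UNIV" for n
      using h0 by (rule measurable_Z)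
    show ?thesis unfolding A_def by measurable
  qed
  have "(\<lambda>k. measure (N 0) (A k)) \<longlonglongrightarrow> measure (N 0) (\<Union>k. A k)"
  proof (rule process.finite_Lim_measure_incseq)
    show "range A \<subseteq> sets (N 0)" using A_meas by blast
    show "incseq A" unfolding incseq_def A_def by (blast intro: order_trans)
  qed
  also have "(\<Union>k. A k) = space (N 0)"
  proof -
    have "\<exists>k. \<omega> \<in> A k" if \<omega>: "\<omega> \<in> space (N 0)" for \<omega>
    proof -
      obtain e where e: "0 < e" "\<And>u. 0 \<le> u \<Longrightarrow> u < 0 + e \<Longrightarrow> Z u \<omega> = Z 0 \<omega>"
        using skip_free_path_constant_right[OF skip_free_Z[OF \<omega>], of 0] by auto
      have "eventually (\<lambda>n. h n < e) sequentially" using h e(1) by (rule order_tendstoD)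
      then obtain k where "\<And>n. n \<ge> k \<Longrightarrow> h n < e" unfolding eventually_sequentially by blast
      then show ?thesis using e(2) h0 \<omega> by (auto simp: A_def intro!: exI[of _ k])
    qed
    then show ?thesis by (auto simp: A_def)
  qed
  finally have lim: "(\<lambda>k. measure (N 0) (A k)) \<longlonglongrightarrow> 1" by (simp add: process.prob_space)
  have lower: "measure (N 0) (A k) \<le> P (h k) 0" for k
  proof -
    have "measure (N 0) (A k) \<le> measure (N 0) {\<omega>\<in>space (N 0). Z 0 \<omega> = Z (0 + h k) \<omega>}"
      using h0[of k] unfolding A_def by (intro process.finite_measure_mono) (fastforce, measurable)
    then show ?thesis using P_stay[of 0 "h k" 0] h0 by simp
  qed
  have upper: "P (h k) 0 \<le> 1" for k
    using law_at[OF h0[of k], of 0 0]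
      process.prob_le_1[of 0 "{\<omega>\<in>space (N 0). Z (h k) \<omega> = 0}"] by simp
  have "(\<lambda>n. P (h n) 0) \<longlonglongrightarrow> 1"
  proof (rule tendsto_sandwich[OF _ _ lim tendsto_const])
    show "\<forall>\<^sub>F n in sequentially. measure (N 0) (A n) \<le> P (h n) 0"
      using lower by (rule always_eventually[OF allI])
    show "\<forall>\<^sub>F n in sequentially. P (h n) 0 \<le> 1"
      using upper by (rule always_eventually[OF allI])
  qed
  then show ?thesis by (simp add: h_def)
qed

text \<open>
  A jump at \<open>s\<close> makes \<open>Z (s - h)\<close> differ from \<open>Z s\<close> for all small \<open>h\<close>, an event of probability
  at most \<open>1 - P h 0\<close> for every such \<open>h\<close>; right-continuity at time \<open>0\<close> makes this bound tend to \<open>0\<close>.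
\<close>

lemma AE_no_jump_at: "AE \<omega> in N x. s \<notin> jump_times (\<lambda>t. Z t \<omega>)"
proof (cases "0 < s")
  case s: True
  define h where "h n = s / real (Suc n)" for n
  have h0: "0 < h n" "h n \<le> s" for n using s by (auto simp: h_def divide_simps)
  have h: "h \<longlonglongrightarrow> 0" unfolding h_def by (intro LIMSEQ_Suc lim_const_over_n)
  have null: "AE \<omega> in N x. \<not> (\<forall>n\<ge>k. Z (s - h n) \<omega> \<noteq> Z s \<omega>)" for k
  proof -
    define B where "B = {\<omega>\<in>space (N x). \<forall>n\<ge>k. Z (s - h n) \<omega> \<noteq> Z s \<omega>}"
    have le: "measure (N x) B \<le> 1 - P (h n) 0" if "n \<ge> k" for n
    proof -
      have "measure (N x) B \<le> measure (N x) (space (N x) - {\<omega>\<in>space (N x). Z (s - h n) \<omega> = Z (s - h n + h n) \<omega>})"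
        using h0[of n] s that by (intro process.finite_measure_mono) (auto simp: B_def)
      also have "\<dots> = 1 - P (h n) 0"
        using h0[of n] s P_stay[of "s - h n" "h n" x]
        by (subst process.prob_compl) auto
      finally show ?thesis .
    qed
    have "(\<lambda>n. 1 - P (h n) 0) \<longlonglongrightarrow> 1 - 1"
      using P_stay_tendsto_1[OF s] by (intro tendsto_intros) (simp add: h_def)
    then have "measure (N x) B \<le> 1 - 1"
      by (rule LIMSEQ_le_const) (use le in blast)
    then have "measure (N x) B = 0" by (simp add: measure_le_0_iff)
    moreover have "B \<in> sets (N x)" 
    proof -
      have [measurable]: "Z (s - h n) \<in> N x \<rightarrow>\<^sub>M count_space UNIV" for n
        using h0[of n] by (intro measurable_Z) simp
      have [measurable]: "Z s \<in> N x \<rightarrow>\<^sub>M count_space UNIV" using s by (intro measurable_Z) simp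
      show ?thesis unfolding B_def by measurable
    qed
    ultimately have "B \<in> null_sets (N x)"
      by (intro null_setsI) (simp_all add: process.emeasure_eq_measure)
    from AE_not_in[OF this] AE_space show ?thesis
      by eventually_elim (auto simp: B_def)
  qed
  then have "AE \<omega> in N x. \<forall>k. \<not> (\<forall>n\<ge>k. Z (s - h n) \<omega> \<noteq> Z s \<omega>)"
    by (simp only: AE_all_countable) blast
  then show ?thesis
  proof (rule AE_mp, intro AE_I2 impI)
    fix \<omega> assume \<omega>: "\<omega> \<in> space (N x)" and often: "\<forall>k. \<not> (\<forall>n\<ge>k. Z (s - h n) \<omega> \<noteq> Z s \<omega>)"
    obtain l where l: "((\<lambda>t. Z t \<omega>) \<longlongrightarrow> l) (at_left s)"
      using skip_free_Z[OF \<omega>] s unfolding skip_free_path_def by blast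
    then obtain b where b: "b < s" "\<And>r. b < r \<Longrightarrow> r < s \<Longrightarrow> Z r \<omega> = l"
      unfolding tendsto_discrete eventually_at_left_field by blast
    have "eventually (\<lambda>n. h n < s - b) sequentially" using h b(1) by (intro order_tendstoD) auto
    then obtain k where k: "\<And>n. n \<ge> k \<Longrightarrow> h n < s - b" unfolding eventually_sequentially by blast
    obtain n where "n \<ge> k" "Z (s - h n) \<omega> = Z s \<omega>" using often by blast
    then have "l = Z s \<omega>" using b(2)[of "s - h n"] k[of n] h0[of n] by simp
    then show "s \<notin> jump_times (\<lambda>t. Z t \<omega>)" using l by (simp add: jump_times_def)
  qed
qed (simp add: jump_times_def)

section \<open>Reflection at the first meeting in a finite set of times\<close>


abbreviation indep_pair :: "int \<Rightarrow> int \<Rightarrow> ('b \<times> 'b) measure" where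
  "indep_pair x x' \<equiv> N x \<Otimes>\<^sub>M N x'"

lemma measurable_Z_fst [measurable]:
  "0 \<le> t \<Longrightarrow> (\<lambda>p. Z t (fst p)) \<in> indep_pair x x' \<rightarrow>\<^sub>M count_space UNIV"
  by (rule measurable_compose[OF measurable_fst measurable_Z])

lemma measurable_Z_snd [measurable]:
  "0 \<le> t \<Longrightarrow> (\<lambda>p. Z t (snd p)) \<in> indep_pair x x' \<rightarrow>\<^sub>M count_space UNIV"
  by (rule measurable_compose[OF measurable_snd measurable_Z])

text \<open>
  By Fubini an identity of section probabilities integrates to one of probabilities.  This lemma and
  its mirror image let the Markov property of one copy be applied while the other
  copy is fixed.
\<close>

lemma emeasure_pair_scale_snd:
  assumes "A \<in> sets (indep_pair x x')" "B \<in> sets (indep_pair x x')"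
    and "\<And>\<omega>. \<omega> \<in> space (N x) \<Longrightarrow>
      measure (N x') (Pair \<omega> -` A) = measure (N x') (Pair \<omega> -` B) * c" "0 \<le> c"
  shows "emeasure (indep_pair x x') A = emeasure (indep_pair x x') B * ennreal c"
proof -
  have "emeasure (indep_pair x x') A = (\<integral>\<^sup>+\<omega>. emeasure (N x') (Pair \<omega> -` B) * ennreal c \<partial>N x)"
    unfolding process.emeasure_pair_measure_alt[OF assms(1)]
    by (intro nn_integral_cong)
      (simp add: process.emeasure_eq_measure assms ennreal_mult)
  also have "\<dots> = (\<integral>\<^sup>+\<omega>. emeasure (N x') (Pair \<omega> -` B) \<partial>N x) * ennreal c"
    by (intro nn_integral_multc process.measurable_emeasure_Pair assms)
  finally show ?thesis by (simp add: process.emeasure_pair_measure_alt[OF assms(2)])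
qed

lemma emeasure_pair_scale_fst:
  assumes "A \<in> sets (indep_pair x x')" "B \<in> sets (indep_pair x x')"
    and "\<And>\<omega>. \<omega> \<in> space (N x') \<Longrightarrow>
      measure (N x) ((\<lambda>\<eta>. (\<eta>, \<omega>)) -` A) = measure (N x) ((\<lambda>\<eta>. (\<eta>, \<omega>)) -` B) * c" "0 \<le> c"
  shows "emeasure (indep_pair x x') A = emeasure (indep_pair x x') B * ennreal c"
proof -
  have "emeasure (indep_pair x x') A = (\<integral>\<^sup>+\<omega>. emeasure (N x) ((\<lambda>\<eta>. (\<eta>, \<omega>)) -` B) * ennreal c \<partial>N x')"
    unfolding pair.emeasure_pair_measure_alt2[OF assms(1)]
    by (intro nn_integral_cong)
      (simp add: process.emeasure_eq_measure assms ennreal_mult)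
  also have "\<dots> = (\<integral>\<^sup>+\<omega>. emeasure (N x) ((\<lambda>\<eta>. (\<eta>, \<omega>)) -` B) \<partial>N x') * ennreal c"
    by (intro nn_integral_multc pair.measurable_emeasure_Pair2 assms)
  finally show ?thesis by (simp add: pair.emeasure_pair_measure_alt2[OF assms(2)])
qed

lemma sets_meet: "0 \<le> r \<Longrightarrow> {p \<in> space (indep_pair x x'). Z r (fst p) = Z r (snd p)} \<in> sets (indep_pair x x')"
  by measurable

lemma sets_fst: "0 \<le> r \<Longrightarrow> {p \<in> space (indep_pair x x'). Z r (fst p) = z} \<in> sets (indep_pair x x')"
  by measurable

lemma sets_snd: "0 \<le> r \<Longrightarrow> {p \<in> space (indep_pair x x'). Z r (snd p) = z} \<in> sets (indep_pair x x')"
  by measurable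

lemmas sets_conditions = sets.sets_Collect_conj sets.sets_Collect_finite_All
  sets.sets_Collect_imp sets.sets_Collect_neg sets.sets_Collect_const sets_meet sets_fst sets_snd

lemma sets_Collect_restrict:
  assumes "A \<in> sets M" "{\<omega>\<in>space M. Q \<omega>} \<in> sets M"
  shows "{\<omega>\<in>A. Q \<omega>} \<in> sets M"
proof -
  have "{\<omega>\<in>A. Q \<omega>} = A \<inter> {\<omega>\<in>space M. Q \<omega>}" using sets.sets_into_space[OF assms(1)] by auto
  then show ?thesis using assms by auto
qed

text \<open>
  The event \<open>H\<close> says that \<open>s\<close> is the first meeting within \<open>F\<close> and that it happens at \<open>z\<close>.
  When one of the paths is fixed, \<open>H\<close> belongs to the past of the other up to time \<open>s\<close>.
  So the Markov property applies first to the second copy and then to the first.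
  The resulting factor is symmetric in \<open>a\<close> and \<open>b\<close>, which is what makes reflection work.
\<close>

lemma markov_from_first_meeting:
  fixes x x' z a b :: int
  assumes F: "finite F" "F \<subseteq> {0..}" and s: "0 \<le> s" and t: "0 \<le> t"
  defines "H \<equiv> {p \<in> space (indep_pair x x'). (\<forall>r\<in>F. r < s \<longrightarrow> Z r (fst p) \<noteq> Z r (snd p)) \<and>
      Z s (fst p) = z \<and> Z s (snd p) = z}"
  shows "emeasure (indep_pair x x') {p \<in> H. Z (s + t) (fst p) = a \<and> Z (s + t) (snd p) = b} =
    emeasure (indep_pair x x') H * ennreal (P t (a - z) * P t (b - z))"
proof -
  have past: "{\<omega>\<in>space (N x). \<forall>r\<in>F. r < s \<longrightarrow> Z r \<omega> \<noteq> c r} \<in> past_events (N x) Z s" for c x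
  proof -
    have "{\<omega>\<in>space (N x). \<forall>r\<in>F. r < s \<longrightarrow> Z r \<omega> \<noteq> c r} =
        {\<omega>\<in>space (N x). \<forall>r\<in>{r \<in> F. r < s}. Z r \<omega> \<noteq> c r}" by blast
    also have "\<dots> \<in> past_events (N x) Z s"
      using F by (intro sigma_past.sets_Collect_finite_All past_events_Z) auto
    finally show ?thesis .
  qed
  define H1 where "H1 = {p \<in> H. Z (s + t) (fst p) = a}"
  have nonneg: "0 \<le> r" if "r \<in> F" for r using F that by auto
  have H_sets: "H \<in> sets (indep_pair x x')"
    unfolding H_def using F(1) s nonneg by (intro sets_conditions) auto
  have H1_sets: "H1 \<in> sets (indep_pair x x')"
    unfolding H1_def by (rule sets_Collect_restrict[OF H_sets sets_fst]) (use s t in simp)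
  have H2_sets: "{p \<in> H1. Z (s + t) (snd p) = b} \<in> sets (indep_pair x x')"
    by (rule sets_Collect_restrict[OF H1_sets sets_snd]) (use s t in simp)
  have "emeasure (indep_pair x x') {p \<in> H1. Z (s + t) (snd p) = b} = emeasure (indep_pair x x') H1 * ennreal (P t (b - z))"
  proof (rule emeasure_pair_scale_snd[OF H2_sets H1_sets _ P_nonneg[OF t]])
    fix \<omega> assume \<omega>: "\<omega> \<in> space (N x)"
    define A where "A = {\<omega>'\<in>space (N x'). \<forall>r\<in>F. r < s \<longrightarrow> Z r \<omega>' \<noteq> Z r \<omega>}"
    have A: "measure (N x') {\<omega>'\<in>A. Z s \<omega>' = z \<and> Z (s + t) \<omega>' = b} =
        measure (N x') {\<omega>'\<in>A. Z s \<omega>' = z} * P t (b - z)"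
      unfolding A_def by (rule markov[OF s t past])
    show "measure (N x') (Pair \<omega> -` {p \<in> H1. Z (s + t) (snd p) = b}) =
        measure (N x') (Pair \<omega> -` H1) * P t (b - z)"
    proof (cases "Z s \<omega> = z \<and> Z (s + t) \<omega> = a")
      case True
      then have "Pair \<omega> -` {p \<in> H1. Z (s + t) (snd p) = b} = {\<omega>'\<in>A. Z s \<omega>' = z \<and> Z (s + t) \<omega>' = b}"
        "Pair \<omega> -` H1 = {\<omega>'\<in>A. Z s \<omega>' = z}"
        using \<omega> by (auto simp: H1_def H_def A_def space_pair_measure)
      then show ?thesis using A by simp
    next
      case False
      then have "Pair \<omega> -` H1 = {}" "Pair \<omega> -` {p \<in> H1. Z (s + t) (snd p) = b} = {}"
        by (auto simp: H1_def H_def)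
      then show ?thesis by (simp only: measure_empty mult_zero_left)
    qed
  qed
  also have "emeasure (indep_pair x x') H1 = emeasure (indep_pair x x') H * ennreal (P t (a - z))"
  proof (rule emeasure_pair_scale_fst[OF H1_sets H_sets _ P_nonneg[OF t]])
    fix \<omega> assume \<omega>: "\<omega> \<in> space (N x')"
    define A where "A = {\<omega>'\<in>space (N x). \<forall>r\<in>F. r < s \<longrightarrow> Z r \<omega>' \<noteq> Z r \<omega>}"
    have A: "measure (N x) {\<omega>'\<in>A. Z s \<omega>' = z \<and> Z (s + t) \<omega>' = a} =
        measure (N x) {\<omega>'\<in>A. Z s \<omega>' = z} * P t (a - z)"
      unfolding A_def by (rule markov[OF s t past])
    show "measure (N x) ((\<lambda>\<eta>. (\<eta>, \<omega>)) -` H1) = measure (N x) ((\<lambda>\<eta>. (\<eta>, \<omega>)) -` H) * P t (a - z)"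
    proof (cases "Z s \<omega> = z")
      case True
      then have "(\<lambda>\<eta>. (\<eta>, \<omega>)) -` H1 = {\<omega>'\<in>A. Z s \<omega>' = z \<and> Z (s + t) \<omega>' = a}"
        "(\<lambda>\<eta>. (\<eta>, \<omega>)) -` H = {\<omega>'\<in>A. Z s \<omega>' = z}"
        using \<omega> by (auto simp: H1_def H_def A_def space_pair_measure)
      then show ?thesis using A by simp
    next
      case False
      then have "(\<lambda>\<eta>. (\<eta>, \<omega>)) -` H1 = {}" "(\<lambda>\<eta>. (\<eta>, \<omega>)) -` H = {}"
        by (auto simp: H1_def H_def)
      then show ?thesis by (simp only: measure_empty mult_zero_left)
    qed
  qed
  finally show ?thesis
    using P_nonneg[OF t] by (simp add: H1_def ennreal_mult mult.assoc conj_assoc)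
qed

text \<open>
  Decompose according to the time and the place of the first meeting within \<open>F\<close>; every term is
  symmetric in \<open>a\<close> and \<open>b\<close> by \<open>markov_from_first_meeting\<close>.
\<close>

lemma reflection_finite:
  assumes F: "finite F" "F \<subseteq> {0..T}" and T: "0 \<le> T"
  shows "measure (indep_pair x x') {p \<in> space (indep_pair x x'). (\<exists>s\<in>F. Z s (fst p) = Z s (snd p)) \<and>
      Z T (fst p) = a \<and> Z T (snd p) = b} =
    measure (indep_pair x x') {p \<in> space (indep_pair x x'). (\<exists>s\<in>F. Z s (fst p) = Z s (snd p)) \<and>
      Z T (fst p) = b \<and> Z T (snd p) = a}"
proof -
  define H where "H = (\<lambda>(s, z). {p \<in> space (indep_pair x x').
      (\<forall>r\<in>F. r < s \<longrightarrow> Z r (fst p) \<noteq> Z r (snd p)) \<and> Z s (fst p) = z \<and> Z s (snd p) = z})"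
  define E where "E a b i = {p \<in> H i. Z T (fst p) = a \<and> Z T (snd p) = b}" for a b i
  have union: "{p \<in> space (indep_pair x x'). (\<exists>s\<in>F. Z s (fst p) = Z s (snd p)) \<and>
      Z T (fst p) = a \<and> Z T (snd p) = b} = (\<Union>i\<in>F \<times> UNIV. E a b i)" (is "?L = ?R") for a b
  proof (intro equalityI subsetI)
    fix p assume p: "p \<in> ?L"
    define S where "S = {s \<in> F. Z s (fst p) = Z s (snd p)}"
    have S: "finite S" "S \<noteq> {}" using p F by (auto simp: S_def)
    obtain s where s: "s \<in> S" "\<And>r. r < s \<Longrightarrow> r \<notin> S"
      using Min_in[OF S] Min_le[OF S(1)] by (metis leD)
    have "p \<in> E a b (s, Z s (fst p))"
      using p s(1) s(2) unfolding E_def H_def S_def by auto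
    moreover have "s \<in> F" using s(1) by (simp add: S_def)
    ultimately show "p \<in> ?R" by blast
  next
    fix p assume "p \<in> ?R"
    then obtain s z where s: "s \<in> F" and p: "p \<in> E a b (s, z)" by auto
    have "Z s (fst p) = Z s (snd p)" using p by (simp add: E_def H_def)
    with s have "\<exists>s\<in>F. Z s (fst p) = Z s (snd p)" by blast
    then show "p \<in> ?L" using p by (auto simp only: E_def H_def prod.case mem_Collect_eq)
  qed
  have E_sets: "E a b i \<in> sets (indep_pair x x')" if "i \<in> F \<times> UNIV" for a b i
  proof -
    obtain s z where i: "i = (s, z)" by (cases i)
    have eq: "i = (s, z)" "0 \<le> s" using i that F by auto
    have nonneg: "0 \<le> r" if "r \<in> F" for r using F that by auto
    have "H i \<in> sets (indep_pair x x')"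
      unfolding eq H_def prod.case using F(1) eq(2) nonneg by (intro sets_conditions) auto
    then show ?thesis
      unfolding E_def by (rule sets_Collect_restrict) (use T in \<open>intro sets_conditions; simp\<close>)
  qed
  have disj: "disjoint_family_on (E a b) (F \<times> UNIV)" for a b
    unfolding disjoint_family_on_def
  proof (intro ballI impI)
    fix i j :: "real \<times> int" assume ij: "i \<in> F \<times> UNIV" "j \<in> F \<times> UNIV" "i \<noteq> j"
    obtain s z r w where eq: "i = (s, z)" "j = (r, w)" by (cases i, cases j) auto
    show "E a b i \<inter> E a b j = {}"
      using ij unfolding eq by (cases s r rule: linorder_cases) (auto simp: E_def H_def)
  qed
  have "emeasure (indep_pair x x') (\<Union>i\<in>F \<times> UNIV. E a b i) = emeasure (indep_pair x x') (\<Union>i\<in>F \<times> UNIV. E b a i)"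
  proof -
    have ct: "countable (F \<times> (UNIV :: int set))" using F by (intro countable_SIGMA) (auto intro: countable_finite)
    have "emeasure (indep_pair x x') (E a b i) = emeasure (indep_pair x x') (E b a i)" if i: "i \<in> F \<times> UNIV" for i
    proof -
      obtain s z where eq: "i = (s, z)" "s \<in> F" using i by (cases i) auto
      have "F \<subseteq> {0..}" "0 \<le> s" "0 \<le> T - s" using F eq by auto
      from markov_from_first_meeting[OF F(1) this, of x x' z]
      show ?thesis unfolding E_def H_def eq by (simp add: mult.commute)
    qed
    then show ?thesis
      by (subst (1 2) emeasure_UN_countable[OF _ ct disj])
        (auto intro!: E_sets nn_integral_cong)
  qed
  then show ?thesis unfolding union measure_def by simp
qed

section \<open>The Karlin--McGregor formula for two particles\<close>


abbreviation meet_by :: "real \<Rightarrow> 'b \<times> 'b \<Rightarrow> bool" where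
  "meet_by T p \<equiv> \<exists>s\<in>{0..T}. Z s (fst p) = Z s (snd p)"

lemma meet_by_iff_sample_times:
  assumes "p \<in> space (indep_pair x x')" "0 \<le> T"
  shows "meet_by T p \<longleftrightarrow> (\<exists>s\<in>sample_times T. Z s (fst p) = Z s (snd p))"
proof -
  have "skip_free_path (\<lambda>t. Z t (fst p))" "skip_free_path (\<lambda>t. Z t (snd p))"
    using assms(1) by (auto simp: space_pair_measure intro: skip_free_Z)
  from meet_iff_sample_times[OF this assms(2)] show ?thesis .
qed

lemma sets_meet_by: "0 \<le> T \<Longrightarrow> {p \<in> space (indep_pair x x'). meet_by T p} \<in> sets (indep_pair x x')"
proof -
  assume T: "0 \<le> T"
  have "{p \<in> space (indep_pair x x'). meet_by T p} =
      {p \<in> space (indep_pair x x'). \<exists>s\<in>sample_times T. Z s (fst p) = Z s (snd p)}"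
    using meet_by_iff_sample_times[OF _ T] by blast
  also have "\<dots> \<in> sets (indep_pair x x')"
    using sample_times_subset[OF T] countable_sample_times
    by (intro sets.sets_Collect_countable_Ex' sets_meet) auto
  finally show ?thesis .
qed

lemma reflection:
  assumes T: "0 \<le> T"
  shows "measure (indep_pair x x') {p \<in> space (indep_pair x x'). meet_by T p \<and> Z T (fst p) = a \<and> Z T (snd p) = b} =
    measure (indep_pair x x') {p \<in> space (indep_pair x x'). meet_by T p \<and> Z T (fst p) = b \<and> Z T (snd p) = a}"
proof -
  \<comment> \<open>finite sets of times that increase to \<open>sample_times T\<close>\<close>
  define F where "F n = from_nat_into (sample_times T) ` {..n}" for n
  have ne: "sample_times T \<noteq> {}" by (auto simp: sample_times_def)
  have UF: "(\<Union>n. F n) = sample_times T"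
  proof -
    have "(\<Union>n. F n) = range (from_nat_into (sample_times T))" by (auto simp: F_def)
    then show ?thesis using ne countable_sample_times by simp
  qed
  then have F: "finite (F n)" "F n \<subseteq> {0..T}" for n
    using sample_times_subset[OF T] by (auto simp: F_def)
  define E where "E a b n = {p \<in> space (indep_pair x x'). (\<exists>s\<in>F n. Z s (fst p) = Z s (snd p)) \<and>
      Z T (fst p) = a \<and> Z T (snd p) = b}" for a b n
  have E_sets: "E a b n \<in> sets (indep_pair x x')" for a b n
  proof -
    have "0 \<le> s" if "s \<in> F n" for s using F(2)[of n] that by auto
    then show ?thesis unfolding E_def using F(1)[of n] T by (intro sets_conditions sets.sets_Collect_finite_Ex) auto
  qed
  have "(\<lambda>n. measure (indep_pair x x') (E a b n)) \<longlonglongrightarrow> measure (indep_pair x x')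
      {p \<in> space (indep_pair x x'). meet_by T p \<and> Z T (fst p) = a \<and> Z T (snd p) = b}" for a b
  proof -
    have "(\<lambda>n. measure (indep_pair x x') (E a b n)) \<longlonglongrightarrow> measure (indep_pair x x') (\<Union>n. E a b n)"
    proof (rule pair.finite_Lim_measure_incseq)
      show "range (E a b) \<subseteq> sets (indep_pair x x')" using E_sets by blast
      show "incseq (E a b)"
        unfolding incseq_def E_def F_def by (fastforce intro: order_trans)
    qed
    also have "(\<Union>n. E a b n) =
        {p \<in> space (indep_pair x x'). (\<exists>s\<in>(\<Union>n. F n). Z s (fst p) = Z s (snd p)) \<and> Z T (fst p) = a \<and> Z T (snd p) = b}"
      unfolding E_def by blast
    also have "\<dots> = {p \<in> space (indep_pair x x'). meet_by T p \<and> Z T (fst p) = a \<and> Z T (snd p) = b}"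
      unfolding UF using meet_by_iff_sample_times[OF _ T] by blast
    finally show ?thesis .
  qed
  note lim = this
  have "measure (indep_pair x x') (E a b n) = measure (indep_pair x x') (E b a n)" for n
    unfolding E_def by (rule reflection_finite[OF F T])
  with lim[of a b] lim[of b a] show ?thesis by (simp only: LIMSEQ_unique)
qed

lemma pair_law:
  assumes T: "0 \<le> T"
  shows "measure (indep_pair x x') {p \<in> space (indep_pair x x'). Z T (fst p) = a \<and> Z T (snd p) = b} =
    P T (a - x) * P T (b - x')"
proof -
  have "{p \<in> space (indep_pair x x'). Z T (fst p) = a \<and> Z T (snd p) = b} =
      {\<omega>\<in>space (N x). Z T \<omega> = a} \<times> {\<omega>\<in>space (N x'). Z T \<omega> = b}"
    by (auto simp: space_pair_measure)
  also have "measure (indep_pair x x') \<dots> = P T (a - x) * P T (b - x')"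
    using T law_at[OF T] P_nonneg[OF T]
    by (subst measure_def, subst process.emeasure_pair_measure_Times)
      (simp_all add: process.emeasure_eq_measure enn2real_mult)
  finally show ?thesis .
qed

lemma AE_pair_start: "AE p in indep_pair x x'. Z 0 (fst p) = x \<and> Z 0 (snd p) = x'"
proof -
  have "measure (N 0) {\<omega>\<in>space (N 0). Z 0 \<omega> = 0} = 1"
    using AE_start[of 0] by (intro process.prob_Collect_eq_1[THEN iffD2]) auto
  then have "P 0 0 = 1" by (simp add: law_at)
  then have "measure (indep_pair x x') {p \<in> space (indep_pair x x'). Z 0 (fst p) = x \<and> Z 0 (snd p) = x'} = 1"
    by (simp add: pair_law)
  then show ?thesis
    by (subst (asm) pair.prob_Collect_eq_1) (intro sets_conditions, simp_all)
qed

text \<open>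
  For a fixed first path the exceptional second paths jump at one of countably many given times,
  so they form a null set.
\<close>

lemma AE_no_crossing:
  assumes T: "0 \<le> T" and less: "x < x'"
  shows "AE p in indep_pair x x'. meet_by T p \<or> Z T (fst p) < Z T (snd p)"
proof -
  \<comment> \<open>The starting points belong to the event because they are prescribed only almost surely.\<close>
  define C where "C = {p \<in> space (indep_pair x x'). Z 0 (fst p) = x \<and> Z 0 (snd p) = x' \<and>
      \<not> meet_by T p \<and> \<not> Z T (fst p) < Z T (snd p)}"
  have C_sets: "C \<in> sets (indep_pair x x')"
  proof -
    have "{p \<in> space (indep_pair x x'). Z T (fst p) < Z T (snd p)} \<in> sets (indep_pair x x')"
      using measurable_Z_fst[OF T] measurable_Z_snd[OF T] by measurable
    then show ?thesis
      unfolding C_def using T by (intro sets_conditions sets_meet_by) auto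
  qed
  have "emeasure (N x') (Pair \<omega> -` C) = 0" if \<omega>: "\<omega> \<in> space (N x)" for \<omega>
  proof -
    have "AE \<omega>' in N x'. \<forall>s\<in>jump_times (\<lambda>t. Z t \<omega>). s \<notin> jump_times (\<lambda>t. Z t \<omega>')"
      using countable_jump_times[OF skip_free_Z[OF \<omega>]] AE_no_jump_at by (simp add: AE_ball_countable)
    then have "AE \<omega>' in N x'. \<omega>' \<notin> Pair \<omega> -` C"
    proof (rule AE_mp, intro AE_I2 impI notI)
      fix \<omega>' assume \<omega>': "\<omega>' \<in> space (N x')" "\<omega>' \<in> Pair \<omega> -` C"
        and disj: "\<forall>s\<in>jump_times (\<lambda>t. Z t \<omega>). s \<notin> jump_times (\<lambda>t. Z t \<omega>')"
      have apart: "\<And>s. s \<in> {0..T} \<Longrightarrow> Z s \<omega> \<noteq> Z s \<omega>'"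
        and start: "Z 0 \<omega> < Z 0 \<omega>'" and le: "\<not> Z T \<omega> < Z T \<omega>'"
        using \<omega>'(2) less by (auto simp: C_def)
      have "Z T \<omega> \<noteq> Z T \<omega>'" using apart[of T] T by simp
      with le have "Z T \<omega>' < Z T \<omega>" by linarith
      from crossing_needs_simultaneous_jump[OF skip_free_Z[OF \<omega>] skip_free_Z[OF \<omega>'(1)] start this T apart]
      show False using disj by blast
    qed
    then show ?thesis
      using AE_iff_null_sets[OF sets_Pair1[OF C_sets], of \<omega>] by (simp only: null_setsD1)
  qed
  then have "emeasure (indep_pair x x') C = 0"
    unfolding process.emeasure_pair_measure_alt[OF C_sets] by (simp cong: nn_integral_cong)
  then have "C \<in> null_sets (indep_pair x x')" using C_sets by (rule null_setsI)
  from AE_not_in[OF this] AE_pair_start AE_space show ?thesis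
    by eventually_elim (auto simp: C_def)
qed

text \<open>
  Paths that end in the reversed order \<open>(b, a)\<close> have almost surely met, so by reflection they are as likely as
  paths that meet and end at \<open>(a, b)\<close>.  Subtracting them from all paths that end
  at \<open>(a, b)\<close> leaves those that do not meet.
\<close>

lemma karlin_mcgregor:
  assumes T: "0 \<le> T" and x: "x < x'" and a: "a < b"
  shows "measure (indep_pair x x') {p \<in> space (indep_pair x x'). \<not> meet_by T p \<and> Z T (fst p) = a \<and> Z T (snd p) = b} =
    P T (a - x) * P T (b - x') - P T (b - x) * P T (a - x')"
proof -
  define Q where "Q a b = {p \<in> space (indep_pair x x'). Z T (fst p) = a \<and> Z T (snd p) = b}" for a b
  define U where "U a b = {p \<in> space (indep_pair x x'). meet_by T p \<and> Z T (fst p) = a \<and> Z T (snd p) = b}" for a b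
  have U_sets: "U a b \<in> sets (indep_pair x x')" for a b
    unfolding U_def using T by (intro sets_conditions sets_meet_by) auto
  have Q_sets: "Q a b \<in> sets (indep_pair x x')" for a b
    unfolding Q_def using T by (intro sets_conditions) auto
  have "measure (indep_pair x x') (Q b a) = measure (indep_pair x x') (U b a)"
  proof (rule pair.finite_measure_eq_AE[OF _ Q_sets U_sets])
    show "AE p in indep_pair x x'. p \<in> Q b a \<longleftrightarrow> p \<in> U b a"
      using AE_no_crossing[OF T x]
      by eventually_elim (use a in \<open>auto simp: Q_def U_def\<close>)
  qed
  also have "\<dots> = measure (indep_pair x x') (U a b)"
    unfolding U_def by (rule reflection[OF T])
  finally have eq: "measure (indep_pair x x') (U a b) = P T (b - x) * P T (a - x')"
    using pair_law[OF T] by (simp add: Q_def)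
  have "{p \<in> space (indep_pair x x'). \<not> meet_by T p \<and> Z T (fst p) = a \<and> Z T (snd p) = b} = Q a b - U a b"
    by (auto simp: Q_def U_def)
  also have "measure (indep_pair x x') \<dots> = measure (indep_pair x x') (Q a b) - measure (indep_pair x x') (U a b)"
    by (rule pair.finite_measure_Diff[OF Q_sets U_sets]) (auto simp: Q_def U_def)
  finally show ?thesis using eq pair_law[OF T] by (simp add: Q_def)
qed

end

section \<open>Two particles of the coalescing system\<close>

text \<open>
  By right-continuity the paths agree at the infimum of the meeting times, so from then on the
  added particle indeed has a path to follow.
\<close>

lemma coalesce_two:
  assumes "x \<noteq> x'" and f: "skip_free_path (w x)" and g: "skip_free_path (w x')"
  shows "coalesce [x, x'] w x' t = w x' t"
    and "coalesce [x, x'] w x t = (if \<exists>s\<in>{0..t}. w x s = w x' s then w x' t else w x t)"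
proof -
  have attach_empty: "attach {} F g = g" for F g by (rule ext) (simp add: attach_def Let_def)
  show "coalesce [x, x'] w x' t = w x' t"
    using assms(1) by (simp add: Let_def attach_empty)
  have "coalesce [x, x'] w x t = attach {x'} w (w x) t"
    by (simp add: Let_def attach_empty)
  also have "\<dots> = (if \<exists>s\<in>{0..t}. w x s = w x' s then w x' t else w x t)"
  proof (cases "\<exists>s\<in>{0..t}. w x s = w x' s")
    case True
    define S where "S = {s \<in> {0..t}. w x' s = w x s}"
    have "S \<noteq> {}" using True by (auto simp: S_def)
    then have "Inf S \<in> S" unfolding S_def by (rule first_time_attained[OF g f])
    then have "{b \<in> {x'}. w b (Inf S) = w x (Inf S)} = {x'}" by (auto simp: S_def)
    moreover have "{s \<in> {0..t}. \<exists>b\<in>{x'}. w b s = w x s} = S" by (simp add: S_def)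
    ultimately show ?thesis
      using \<open>S \<noteq> {}\<close> True by (simp only: attach_def Let_def if_False if_True Min_singleton)
  next
    case False
    then have "{s \<in> {0..t}. \<exists>b\<in>{x'}. w b s = w x s} = {}"
      by (auto dest: sym)
    then show ?thesis using False by (simp only: attach_def Let_def if_True if_False simp_thms)
  qed
  finally show "coalesce [x, x'] w x t = (if \<exists>s\<in>{0..t}. w x s = w x' s then w x' t else w x t)" .
qed

lemma sets_Collect_countable_rel:
  fixes f :: "'c \<Rightarrow> 'd::countable" and g :: "'c \<Rightarrow> 'e::countable"
  assumes "f \<in> M \<rightarrow>\<^sub>M count_space UNIV" "g \<in> M \<rightarrow>\<^sub>M count_space UNIV"
  shows "{\<omega>\<in>space M. R (f \<omega>) (g \<omega>)} \<in> sets M"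
proof -
  have "(\<lambda>\<omega>. (f \<omega>, g \<omega>)) \<in> M \<rightarrow>\<^sub>M count_space UNIV \<Otimes>\<^sub>M count_space UNIV"
    using assms by measurable
  then have "(\<lambda>\<omega>. (f \<omega>, g \<omega>)) \<in> M \<rightarrow>\<^sub>M count_space (UNIV \<times> UNIV)"
    by (simp only: pair_measure_countable countableI_type)
  from measurable_sets[OF this, of "{(a, b). R a b}"]
  have "(\<lambda>\<omega>. (f \<omega>, g \<omega>)) -` {(a, b). R a b} \<inter> space M \<in> sets M" by simp
  also have "(\<lambda>\<omega>. (f \<omega>, g \<omega>)) -` {(a, b). R a b} \<inter> space M = {\<omega>\<in>space M. R (f \<omega>) (g \<omega>)}"
    by auto
  finally show ?thesis .
qed

context translation_invariant_process
begin

lemma distr_PiM_pair: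
  assumes "x \<noteq> x'"
  shows "distr (PiM {x, x'} N) (indep_pair x x') (\<lambda>\<omega>. (\<omega> x, \<omega> x')) = indep_pair x x'"
proof -
  interpret product_prob_space N by unfold_locales
  have phi: "(\<lambda>\<omega>. (\<omega> x, \<omega> x')) \<in> PiM {x, x'} N \<rightarrow>\<^sub>M indep_pair x x'"
    by (intro measurable_Pair measurable_component_singleton) auto
  have "indep_pair x x' = distr (PiM {x, x'} N) (indep_pair x x') (\<lambda>\<omega>. (\<omega> x, \<omega> x'))"
  proof (rule pair_measure_eqI)
    fix A B assume AB: "A \<in> sets (N x)" "B \<in> sets (N x')"
    have "(\<lambda>\<omega>. (\<omega> x, \<omega> x')) -` (A \<times> B) \<inter> space (PiM {x, x'} N) =
        (\<Pi>\<^sub>E i\<in>{x, x'}. if i = x then A else B)"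
      using assms AB[THEN sets.sets_into_space]
      by (auto simp: space_PiM PiE_iff split: if_splits)
    then have "emeasure (distr (PiM {x, x'} N) (indep_pair x x') (\<lambda>\<omega>. (\<omega> x, \<omega> x'))) (A \<times> B) =
        emeasure (PiM {x, x'} N) (\<Pi>\<^sub>E i\<in>{x, x'}. if i = x then A else B)"
      using AB by (simp add: emeasure_distr[OF phi])
    also have "\<dots> = (\<Prod>i\<in>{x, x'}. emeasure (N i) (if i = x then A else B))"
      using AB by (intro emeasure_PiM) auto
    also have "\<dots> = emeasure (N x) A * emeasure (N x') B"
      using assms by simp
    finally show "emeasure (N x) A * emeasure (N x') B =
        emeasure (distr (PiM {x, x'} N) (indep_pair x x') (\<lambda>\<omega>. (\<omega> x, \<omega> x'))) (A \<times> B)" by simp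
  qed (auto intro: process.sigma_finite_measure_axioms)
  then show ?thesis by simp
qed

text \<open>
  The position of the particle with the smaller starting site, which is the one that gives up its own
  path when the two meet.
\<close>

definition merged :: "real \<Rightarrow> 'b \<times> 'b \<Rightarrow> int" where
  "merged T p = (if meet_by T p then Z T (snd p) else Z T (fst p))"

lemma measurable_merged: "0 \<le> T \<Longrightarrow> merged T \<in> indep_pair x x' \<rightarrow>\<^sub>M count_space UNIV"
  unfolding merged_def by (intro measurable_If measurable_Z_fst measurable_Z_snd sets_meet_by) auto

lemma coalesce_two_Z:
  assumes "x < x'" "\<omega> \<in> space (PiM {x, x'} N)"
  shows "coalesce (sorted_list_of_set {x, x'}) (\<lambda>a s. Z s (\<omega> a)) x' t = Z t (\<omega> x')"
    and "coalesce (sorted_list_of_set {x, x'}) (\<lambda>a s. Z s (\<omega> a)) x t = merged t (\<omega> x, \<omega> x')"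
proof -
  have list: "sorted_list_of_set {x, x'} = [x, x']" using assms(1) by simp
  have "\<omega> x \<in> space (N x)" "\<omega> x' \<in> space (N x')"
    using assms(2) by (auto simp: space_PiM PiE_iff)
  then have paths: "skip_free_path (\<lambda>s. Z s (\<omega> x))" "skip_free_path (\<lambda>s. Z s (\<omega> x'))"
    by (auto intro: skip_free_Z)
  have "x \<noteq> x'" using assms(1) by simp
  from coalesce_two[where w = "\<lambda>a s. Z s (\<omega> a)", OF this paths]
  show "coalesce (sorted_list_of_set {x, x'}) (\<lambda>a s. Z s (\<omega> a)) x' t = Z t (\<omega> x')"
    "coalesce (sorted_list_of_set {x, x'}) (\<lambda>a s. Z s (\<omega> a)) x t = merged t (\<omega> x, \<omega> x')"
    unfolding list merged_def fst_conv snd_conv by blast+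
qed

end

locale coalescing_flow = translation_invariant_process N Z P
  for N :: "int \<Rightarrow> 'b measure" and Z :: "real \<Rightarrow> 'b \<Rightarrow> int" and P :: "real \<Rightarrow> int \<Rightarrow> real" +
  fixes M :: "'a measure" and X :: "int \<Rightarrow> real \<Rightarrow> 'a \<Rightarrow> int"
  assumes system: "coalescing_system N Z M X"
begin

sublocale M: prob_space M
  using system unfolding coalescing_system_def by blast

lemma measurable_X: "0 \<le> t \<Longrightarrow> X x t \<in> M \<rightarrow>\<^sub>M count_space UNIV"
  using system unfolding coalescing_system_def by blast

text \<open>
  The gap statistics depend on the coalescing system only through the joint law of two particles at
  the single time \<open>T\<close>.  The relation \<open>R\<close> covers events about their values, their order and
  one of them alone.
\<close>

lemma two_particle_law:
  assumes T: "0 \<le> T" and x: "x < x'"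
  shows "measure M {\<omega>\<in>space M. R (X x T \<omega>) (X x' T \<omega>)} =
    measure (indep_pair x x') {p \<in> space (indep_pair x x'). R (merged T p) (Z T (snd p))}"
proof -
  define I where "I = {x, x'} \<times> {0::real..}"
  define C where "C = PiM I (\<lambda>_. count_space (UNIV :: int set))"
  define \<phi> where "\<phi> \<omega> = (\<omega> x, \<omega> x')" for \<omega> :: "int \<Rightarrow> 'b"
  define G where "G \<omega> = (\<lambda>(c, t)\<in>I. coalesce (sorted_list_of_set {x, x'}) (\<lambda>a s. Z s (\<omega> a)) c t)" for \<omega>
  define H where "H \<omega> = (\<lambda>(c, t)\<in>I. X c t \<omega>)" for \<omega>
  define B where "B = {f \<in> space C. R (f (x, T)) (f (x', T))}"
  have I: "(x, T) \<in> I" "(x', T) \<in> I" using T by (auto simp: I_def)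
  have law: "distr M C H = distr (PiM {x, x'} N) C G"
    using system unfolding coalescing_system_def finite_coalescing_law_def C_def G_def H_def I_def
    by simp
  have \<phi>: "\<phi> \<in> PiM {x, x'} N \<rightarrow>\<^sub>M indep_pair x x'"
    unfolding \<phi>_def by (intro measurable_Pair measurable_component_singleton) auto
  have H: "H \<in> M \<rightarrow>\<^sub>M C"
    unfolding H_def C_def by (intro measurable_restrict) (auto simp: I_def intro: measurable_X)
  have G: "G \<in> PiM {x, x'} N \<rightarrow>\<^sub>M C"
    unfolding G_def C_def
  proof (intro measurable_restrict)
    fix i assume i: "i \<in> I"
    then obtain c t where ct: "i = (c, t)" "c \<in> {x, x'}" "0 \<le> t" by (auto simp: I_def)
    have "(\<lambda>\<omega>. coalesce (sorted_list_of_set {x, x'}) (\<lambda>a s. Z s (\<omega> a)) c t)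
        \<in> PiM {x, x'} N \<rightarrow>\<^sub>M count_space UNIV"
    proof (cases "c = x")
      case True
      have "(\<lambda>\<omega>. merged t (\<phi> \<omega>)) \<in> PiM {x, x'} N \<rightarrow>\<^sub>M count_space UNIV"
        by (rule measurable_compose[OF \<phi> measurable_merged[OF ct(3)]])
      then show ?thesis
        unfolding True \<phi>_def using coalesce_two_Z(2)[OF x] by (simp cong: measurable_cong)
    next
      case False
      then have c: "c = x'" using ct by auto
      have "(\<lambda>\<omega>. Z t (\<omega> x')) \<in> PiM {x, x'} N \<rightarrow>\<^sub>M count_space UNIV"
        by (rule measurable_compose[OF _ measurable_Z[OF ct(3)]], rule measurable_component_singleton) simp
      then show ?thesis
        unfolding c using coalesce_two_Z(1)[OF x] by (simp cong: measurable_cong)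
    qed
    then show "(\<lambda>\<omega>. case i of (c, t) \<Rightarrow> coalesce (sorted_list_of_set {x, x'}) (\<lambda>a s. Z s (\<omega> a)) c t)
        \<in> PiM {x, x'} N \<rightarrow>\<^sub>M count_space UNIV" by (simp add: ct)
  qed
  have B: "B \<in> sets C"
    unfolding B_def C_def using I
    by (intro sets_Collect_countable_rel measurable_component_singleton)
  have D: "{p \<in> space (indep_pair x x'). R (merged T p) (Z T (snd p))} \<in> sets (indep_pair x x')"
    by (intro sets_Collect_countable_rel measurable_merged measurable_Z_snd T)
  have "{\<omega>\<in>space M. R (X x T \<omega>) (X x' T \<omega>)} = H -` B \<inter> space M"
    using I measurable_space[OF H] by (auto simp: B_def) (auto simp: H_def)
  then have "measure M {\<omega>\<in>space M. R (X x T \<omega>) (X x' T \<omega>)} = measure (distr M C H) B"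
    by (simp add: measure_distr[OF H B])
  also have "\<dots> = measure (PiM {x, x'} N) (G -` B \<inter> space (PiM {x, x'} N))"
    unfolding law by (rule measure_distr[OF G B])
  also have "G -` B \<inter> space (PiM {x, x'} N) =
      \<phi> -` {p \<in> space (indep_pair x x'). R (merged T p) (Z T (snd p))} \<inter> space (PiM {x, x'} N)"
  proof -
    have "G \<omega> (x, T) = merged T (\<phi> \<omega>)" "G \<omega> (x', T) = Z T (snd (\<phi> \<omega>))"
      if "\<omega> \<in> space (PiM {x, x'} N)" for \<omega>
      using that I coalesce_two_Z[OF x that] by (simp_all add: G_def \<phi>_def)
    then show ?thesis
      using measurable_space[OF G] measurable_space[OF \<phi>] by (auto simp: B_def)
  qed
  also have "measure (PiM {x, x'} N) \<dots> = measure (distr (PiM {x, x'} N) (indep_pair x x') \<phi>)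
      {p \<in> space (indep_pair x x'). R (merged T p) (Z T (snd p))}"
    by (rule measure_distr[OF \<phi> D, symmetric])
  also have "distr (PiM {x, x'} N) (indep_pair x x') \<phi> = indep_pair x x'"
    using distr_PiM_pair x unfolding \<phi>_def by simp
  finally show ?thesis .
qed

lemma one_particle_law:
  assumes T: "0 \<le> T"
  shows "measure M {\<omega>\<in>space M. X x T \<omega> = y} = P T (y - x)"
proof -
  have "measure M {\<omega>\<in>space M. X x T \<omega> = y} =
      measure (indep_pair (x - 1) x) {p \<in> space (indep_pair (x - 1) x). Z T (snd p) = y}"
    using two_particle_law[OF T, of "x - 1" x "\<lambda>_ b. b = y"] by simp
  also have "{p \<in> space (indep_pair (x - 1) x). Z T (snd p) = y} =
      space (N (x - 1)) \<times> {\<omega>\<in>space (N x). Z T \<omega> = y}"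
    by (auto simp: space_pair_measure)
  also have "measure (indep_pair (x - 1) x) \<dots> = P T (y - x)"
    using T law_at[OF T] P_nonneg[OF T]
    by (subst measure_def, subst process.emeasure_pair_measure_Times)
      (simp_all add: process.emeasure_eq_measure process.prob_space)
  finally show ?thesis .
qed

lemma AE_ordered:
  assumes T: "0 \<le> T"
  shows "AE \<omega> in M. \<forall>x. X x T \<omega> \<le> X (x + 1) T \<omega>"
proof -
  have "AE \<omega> in M. X x T \<omega> \<le> X (x + 1) T \<omega>" for x
  proof -
    have "AE p in indep_pair x (x + 1). merged T p \<le> Z T (snd p)"
      using AE_no_crossing[OF T, of x "x + 1"] by (auto simp: merged_def)
    moreover have "{p \<in> space (indep_pair x (x + 1)). merged T p \<le> Z T (snd p)} \<in> sets (indep_pair x (x + 1))"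
      by (intro sets_Collect_countable_rel measurable_merged measurable_Z_snd T)
    ultimately have "measure (indep_pair x (x + 1)) {p \<in> space (indep_pair x (x + 1)). merged T p \<le> Z T (snd p)} = 1"
      by (rule pair.prob_Collect_eq_1[THEN iffD2, rotated])
    then have "measure M {\<omega>\<in>space M. X x T \<omega> \<le> X (x + 1) T \<omega>} = 1"
      using two_particle_law[OF T, of x "x + 1" "(\<le>)"] by simp
    then show ?thesis
      using sets_Collect_countable_rel[OF measurable_X[OF T] measurable_X[OF T]]
      by (subst (asm) M.prob_Collect_eq_1) blast+
  qed
  then show ?thesis by (simp add: AE_all_countable)
qed

text \<open>
  Merged particles cannot be at the different sites \<open>a\<close> and \<open>b\<close>, so the two independent
  copies have not met.
\<close>

lemma neighbours_law:
  assumes T: "0 \<le> T" and ab: "a < b"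
  shows "measure M {\<omega>\<in>space M. X x T \<omega> = a \<and> X (x + 1) T \<omega> = b} =
    P T (a - x) * P T (b - (x + 1)) - P T (b - x) * P T (a - (x + 1))"
proof -
  have "{p \<in> space (indep_pair x (x + 1)). merged T p = a \<and> Z T (snd p) = b} =
      {p \<in> space (indep_pair x (x + 1)). \<not> meet_by T p \<and> Z T (fst p) = a \<and> Z T (snd p) = b}"
    using ab by (auto simp: merged_def)
  then show ?thesis
    using two_particle_law[OF T, of x "x + 1" "\<lambda>u v. u = a \<and> v = b"]
      karlin_mcgregor[OF T _ ab, of x "x + 1"] by simp
qed

end

section \<open>Gaps between consecutive survivors\<close>

lemma mono_int_stepI:
  fixes f :: "int \<Rightarrow> 'c::order"
  assumes "\<And>x. f x \<le> f (x + 1)"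
  shows "mono f"
proof (rule monoI)
  fix x y :: int assume "x \<le> y"
  then show "f x \<le> f y"
    by (induction y rule: int_ge_induct) (auto intro: order_trans assms)
qed

text \<open>
  For the forward direction take \<open>x\<close> to be the last site that is mapped to \<open>y\<close>.
\<close>

lemma consecutive_range_iff:
  fixes f :: "int \<Rightarrow> int"
  assumes mono: "mono f" and less: "y < z"
  shows "consecutive (range f) y z \<longleftrightarrow> (\<exists>x. f x = y \<and> f (x + 1) = z)"
proof
  assume cons: "consecutive (range f) y z"
  then obtain u v where u: "f u = y" and v: "f v = z" unfolding consecutive_def by blast
  define S where "S = {x \<in> {u..v}. f x = y}"
  have "u \<le> v" using monoD[OF mono, of v u] u v less by linarith
  then have S: "finite S" "S \<noteq> {}" using u by (auto simp: S_def intro: finite_subset[of _ "{u..v}"])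
  define x where "x = Max S"
  have x: "x \<in> S" unfolding x_def using S by (rule Max_in)
  have "x \<noteq> v" using x v less by (auto simp: S_def)
  then have "x + 1 \<le> v" "u \<le> x" using x by (auto simp: S_def)
  have "x + 1 \<notin> S" using Max_ge[OF S(1), of "x + 1"] unfolding x_def by linarith
  then have "f (x + 1) \<noteq> y" using \<open>x + 1 \<le> v\<close> \<open>u \<le> x\<close> by (auto simp: S_def)
  moreover have "y \<le> f (x + 1)" using monoD[OF mono, of x "x + 1"] x by (simp add: S_def)
  moreover have "f (x + 1) \<le> z" using monoD[OF mono \<open>x + 1 \<le> v\<close>] v by simp
  moreover have "f (x + 1) \<notin> {y<..<z}" using cons unfolding consecutive_def by blast
  ultimately have "f (x + 1) = z" by simp
  then show "\<exists>x. f x = y \<and> f (x + 1) = z" using x by (auto simp: S_def)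
next
  assume "\<exists>x. f x = y \<and> f (x + 1) = z"
  then obtain x where x: "f x = y" "f (x + 1) = z" by blast
  have "f w \<notin> {y<..<z}" for w
    using monoD[OF mono, of w x] monoD[OF mono, of "x + 1" w] x by (cases "w \<le> x") auto
  then show "consecutive (range f) y z"
    using x less by (auto simp: consecutive_def)
qed

lemma consecutive_left: "consecutive S y z \<Longrightarrow> y \<in> S"
  by (simp add: consecutive_def)

lemma consecutive_unique: "consecutive S y z \<Longrightarrow> consecutive S y w \<Longrightarrow> z = w"
  unfolding consecutive_def by (metis IntI empty_iff greaterThanLessThan_iff linorder_neqE)

lemma ex_consecutive:
  assumes "y \<in> S" "v \<in> S" "y < v"
  shows "\<exists>g\<ge>1. consecutive S y (y + g)"
proof -
  have fin: "finite (S \<inter> {y<..v})" by simp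
  define z where "z = Min (S \<inter> {y<..v})"
  have "S \<inter> {y<..v} \<noteq> {}" using assms by auto
  with fin have z: "z \<in> S \<inter> {y<..v}" unfolding z_def by (rule Min_in)
  have "w \<notin> {y<..<z}" if "w \<in> S" for w
    using Min_le[OF fin, of w] z that unfolding z_def by fastforce
  then show ?thesis using z assms by (auto simp: consecutive_def intro!: exI[of _ "z - y"])
qed

context translation_invariant_process
begin

text \<open>
  The values of \<open>P s\<close> at distinct points are the terms of a convergent series.
\<close>

lemma P_tendsto_0:
  assumes s: "0 \<le> s"
  shows "(\<lambda>n. P s (c - int n)) \<longlonglongrightarrow> 0"
proof -
  have "P s summable_on range (\<lambda>n. c - int n)"
    using P_has_sum_1[OF s] has_sum_imp_summable summable_on_subset_banach by blast
  then have "(P s \<circ> (\<lambda>n. c - int n)) summable_on UNIV"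
    by (subst (asm) summable_on_reindex) (auto simp: inj_on_def)
  then show ?thesis
    using summable_on_imp_summable summable_LIMSEQ_zero by (fastforce simp: comp_def)
qed

lemma convolution:
  assumes s: "0 \<le> s" "0 \<le> t"
  shows "((\<lambda>x. P s (x - a) * P t (b - x)) has_sum P (s + t) (b - a)) UNIV"
proof -
  have "bij_betw (\<lambda>x. x - a) UNIV UNIV"
    by (rule bij_betw_byWitness[where f' = "\<lambda>x. x + a"]) auto
  from has_sum_reindex_bij_betw[OF this, of "\<lambda>x. P s x * P t (b - a - x)"]
    chapman_kolmogorov[OF s, of "b - a"]
  show ?thesis by (simp add: algebra_simps)
qed

end

locale symmetric_coalescing_flow = coalescing_flow +
  assumes sym: "\<And>s n. 0 \<le> s \<Longrightarrow> P s n = P s (- n)"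
begin

text \<open>
  By symmetry \<open>P (2 * T) 0\<close> is at least the square of any single probability \<open>P T n\<close>, and one of
  these is positive.
\<close>

lemma return_positive:
  assumes T: "0 \<le> T"
  shows "0 < P (2 * T) 0"
proof -
  have "\<exists>n. P T n \<noteq> 0"
  proof (rule ccontr)
    assume "\<nexists>n. P T n \<noteq> 0"
    then have "P T = (\<lambda>_. 0)" by auto
    then show False using P_has_sum_1[OF T] has_sum_unique[OF _ has_sum_0[of UNIV "P T"]] by fastforce
  qed
  then obtain n where n: "P T n \<noteq> 0" by blast
  have "0 < P T n * P T n" using n by (metis not_real_square_gt_zero)
  also have "\<dots> = measure (N 0) {\<omega>\<in>space (N 0). Z T \<omega> = n \<and> Z (T + T) \<omega> = 0}"
    using joint_law[OF T T, of 0 n 0] sym[OF T, of n] by simp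
  also have "\<dots> \<le> measure (N 0) {\<omega>\<in>space (N 0). Z (T + T) \<omega> = 0}"
    using T measurable_Z[of "T + T" 0]
    by (intro process.finite_measure_mono) (auto intro: sets_Collect_countable_rel)
  also have "\<dots> = P (2 * T) 0" using T law_at[of "T + T" 0 0] by simp
  finally show ?thesis .
qed

context
  fixes T :: real
  assumes T: "0 \<le> T"
begin

lemma sets_occupied: "{\<omega>\<in>space M. y \<in> survivors X T \<omega>} \<in> sets M"
proof -
  have "{\<omega>\<in>space M. y \<in> survivors X T \<omega>} = {\<omega>\<in>space M. \<exists>x. X x T \<omega> = y}"
    by (auto simp: survivors_def)
  also have "\<dots> \<in> sets M"
    using measurable_X[OF T] by (intro sets.sets_Collect_countable_Ex) simp
  finally show ?thesis .
qed

lemma sets_consecutive: "{\<omega>\<in>space M. consecutive (survivors X T \<omega>) y z} \<in> sets M"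
proof -
  have "{\<omega>\<in>space M. consecutive (survivors X T \<omega>) y z} =
      {\<omega>\<in>space M. y \<in> survivors X T \<omega> \<and> z \<in> survivors X T \<omega> \<and> y < z \<and>
        (\<forall>w\<in>{y<..<z}. \<not> w \<in> survivors X T \<omega>)}"
    by (auto simp: consecutive_def)
  also have "\<dots> \<in> sets M"
    by (intro sets.sets_Collect_conj sets.sets_Collect_finite_All sets.sets_Collect_neg
        sets.sets_Collect_const sets_occupied) auto
  finally show ?thesis .
qed

lemma AE_mono: "AE \<omega> in M. mono (\<lambda>x. X x T \<omega>)"
  using AE_ordered[OF T] by eventually_elim (rule mono_int_stepI, blast)

text \<open>
  The sites \<open>x\<close> with \<open>X x T = y\<close> and \<open>X (x + 1) T = y + g\<close> are unique only where \<open>x \<mapsto> X x T\<close> is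
  nondecreasing.  So the events \<open>D x\<close> are replaced by their traces \<open>D' x\<close> on this almost sure event,
  which are disjoint.
\<close>

lemma gap_probability:
  assumes g: "1 \<le> g"
  shows "measure M {\<omega>\<in>space M. consecutive (survivors X T \<omega>) y (y + g)} =
    P (2 * T) (g - 1) - P (2 * T) (g + 1)"
proof -
  have G_sets: "{\<omega>\<in>space M. \<forall>x. X x T \<omega> \<le> X (x + 1) T \<omega>} \<in> sets M"
    using sets_Collect_countable_rel[OF measurable_X[OF T] measurable_X[OF T]]
    by (intro sets.sets_Collect_countable_All)
  define D where "D x = {\<omega>\<in>space M. X x T \<omega> = y \<and> X (x + 1) T \<omega> = y + g}" for x
  define D' where "D' x = D x \<inter> {\<omega>\<in>space M. \<forall>x. X x T \<omega> \<le> X (x + 1) T \<omega>}" for x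
  have D_sets: "D x \<in> sets M" for x
    unfolding D_def using measurable_X[OF T] by (rule sets_Collect_countable_rel[OF _ measurable_X[OF T]])
  have D'_sets: "D' x \<in> sets M" for x unfolding D'_def using D_sets G_sets by blast
  have ae: "measure M (D x) = measure M (D' x)" for x
    by (rule M.finite_measure_eq_AE[OF _ D_sets D'_sets])
      (use AE_ordered[OF T] in \<open>auto simp: D'_def\<close>)
  have disj: "disjoint_family D'"
    unfolding disjoint_family_on_def
  proof (intro ballI impI)
    have "D' u \<inter> D' v = {}" if "u < v" for u v
    proof -
      have False if \<omega>: "\<omega> \<in> D' u" "\<omega> \<in> D' v" for \<omega>
      proof -
        have "mono (\<lambda>x. X x T \<omega>)" using \<omega> by (intro mono_int_stepI) (auto simp: D'_def)
        then have "X (u + 1) T \<omega> \<le> X v T \<omega>" using \<open>u < v\<close> by (auto dest: monoD[of _ "u + 1" v])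
        then show False using \<omega> g by (auto simp: D'_def D_def)
      qed
      then show ?thesis by blast
    qed
    then show "D' u \<inter> D' v = {}" if "u \<noteq> v" for u v
      using that by (metis Int_commute linorder_neqE)
  qed
  have "measure M (\<Union>x. D' x) = measure M {\<omega>\<in>space M. consecutive (survivors X T \<omega>) y (y + g)}"
  proof (rule M.finite_measure_eq_AE)
    show "AE \<omega> in M. \<omega> \<in> (\<Union>x. D' x) \<longleftrightarrow> \<omega> \<in> {\<omega>\<in>space M. consecutive (survivors X T \<omega>) y (y + g)}"
      using AE_ordered[OF T] AE_mono AE_space
    proof eventually_elim
      case (elim \<omega>)
      then show ?case
        using consecutive_range_iff[OF elim(2), of y "y + g"] g
        by (auto simp: survivors_def D'_def D_def)
    qed
  qed (use D'_sets sets_consecutive in auto)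
  then have "((\<lambda>x. measure M (D x)) has_sum
      measure M {\<omega>\<in>space M. consecutive (survivors X T \<omega>) y (y + g)}) UNIV"
    using M.has_sum_measure_disjoint_int[OF D'_sets disj] unfolding ae by simp
  moreover have "((\<lambda>x. measure M (D x)) has_sum (P (2 * T) (g - 1) - P (2 * T) (g + 1))) UNIV"
  proof -
    have "((\<lambda>x. P T (x - y) * P T (y + g - 1 - x) - P T (x - (y + g)) * P T (y - 1 - x)) has_sum
        (P (T + T) (y + g - 1 - y) - P (T + T) (y - 1 - (y + g)))) UNIV"
      using has_sum_add[OF convolution[OF T T, of y "y + g - 1"]
          has_sum_uminusI[OF convolution[OF T T, of "y + g" "y - 1"]]] by simp
    moreover have "P (T + T) (y + g - 1 - y) - P (T + T) (y - 1 - (y + g)) =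
        P (2 * T) (g - 1) - P (2 * T) (g + 1)"
      using sym[of "2 * T" "g + 1"] T by (simp add: algebra_simps)
    moreover have "measure M (D x) =
        P T (x - y) * P T (y + g - 1 - x) - P T (x - (y + g)) * P T (y - 1 - x)" for x
      using neighbours_law[OF T, of y "y + g" x] g sym[OF T, of "x - y"] sym[OF T, of "x - (y + g)"]
      by (simp add: D_def algebra_simps)
    ultimately show ?thesis by simp
  qed
  ultimately show ?thesis by (rule has_sum_unique)
qed

text \<open>
  With \<open>p n = P (2 * T) n\<close> the terms are \<open>p n - p (n + 2)\<close>, so the sum telescopes.  As gap
  probabilities they are nonnegative, which turns the convergent series into an unordered sum.
\<close>

lemma gap_sum:
  "((\<lambda>g. P (2 * T) (g - 1) - P (2 * T) (g + 1)) has_sum (P (2 * T) 0 + P (2 * T) 1)) {1..}"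
proof -
  have T2: "0 \<le> 2 * T" using T by simp
  define p where "p n = P (2 * T) (int n)" for n
  have p0: "p \<longlonglongrightarrow> 0"
    using P_tendsto_0[OF T2, of 0] sym[OF T2] by (simp add: p_def[abs_def])
  have "(\<lambda>n. (- p (Suc n) - p (Suc (Suc n))) - (- p n - p (Suc n))) sums ((- 0 - 0) - (- p 0 - p (Suc 0)))"
    by (rule telescope_sums) (intro tendsto_intros p0 LIMSEQ_Suc)
  then have "(\<lambda>n. p n - p (Suc (Suc n))) sums (P (2 * T) 0 + P (2 * T) 1)"
    by (simp add: p_def add.commute)
  then have "((\<lambda>n. p n - p (Suc (Suc n))) has_sum (P (2 * T) 0 + P (2 * T) 1)) UNIV"
  proof (rule sums_nonneg_imp_has_sum)
    fix n show "0 \<le> p n - p (Suc (Suc n))"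
      using gap_probability[of "int n + 1" 0]
        measure_nonneg[of M "{\<omega>\<in>space M. consecutive (survivors X T \<omega>) 0 (0 + (int n + 1))}"]
      by (simp add: p_def add.commute)
  qed
  moreover have "bij_betw (\<lambda>n. int n + 1) UNIV {1..}"
    by (rule bij_betw_byWitness[where f' = "\<lambda>g. nat (g - 1)"]) auto
  ultimately show ?thesis
    using has_sum_reindex_bij_betw[of "\<lambda>n. int n + 1" UNIV "{1..}"
        "\<lambda>g. P (2 * T) (g - 1) - P (2 * T) (g + 1)"]
    by (simp add: p_def algebra_simps)
qed

text \<open>
  If no survivor lies above \<open>y\<close>, then all sites from some \<open>u\<close> on are mapped to \<open>y\<close>.  For
  each \<open>u\<close> this has probability at most \<open>P T (y - u - n)\<close> for every \<open>n\<close>.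
\<close>

lemma AE_next_survivor: "AE \<omega> in M. y \<in> survivors X T \<omega> \<longrightarrow> (\<exists>g\<ge>1. consecutive (survivors X T \<omega>) y (y + g))"
proof -
  have "AE \<omega> in M. \<not> (\<forall>n. X (u + int n) T \<omega> = y)" for u
  proof -
    define S where "S = {\<omega>\<in>space M. \<forall>n. X (u + int n) T \<omega> = y}"
    have X_sets: "{\<omega>\<in>space M. X x T \<omega> = y} \<in> sets M" for x
      using measurable_X[OF T] by simp
    have S_sets: "S \<in> sets M" unfolding S_def by (intro sets.sets_Collect_countable_All X_sets)
    have "measure M S \<le> P T (y - u - int n)" for n
    proof -
      have "measure M S \<le> measure M {\<omega>\<in>space M. X (u + int n) T \<omega> = y}"
        by (rule M.finite_measure_mono[OF _ X_sets]) (auto simp: S_def)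
      then show ?thesis by (simp add: one_particle_law[OF T] algebra_simps)
    qed
    then have "measure M S \<le> 0"
      by (intro LIMSEQ_le_const[OF P_tendsto_0[OF T]]) blast
    then have "measure M S = 0" by (simp add: measure_le_0_iff)
    then have "S \<in> null_sets M" using S_sets by (simp add: null_setsI M.emeasure_eq_measure)
    from AE_not_in[OF this] AE_space show ?thesis by eventually_elim (auto simp: S_def)
  qed
  then have "AE \<omega> in M. \<forall>u. \<not> (\<forall>n. X (u + int n) T \<omega> = y)" by (simp add: AE_all_countable)
  with AE_mono show ?thesis
  proof eventually_elim
    case (elim \<omega>)
    show ?case
    proof
      assume y: "y \<in> survivors X T \<omega>"
      then obtain u where u: "X u T \<omega> = y" by (auto simp: survivors_def)
      obtain n where "X (u + int n) T \<omega> \<noteq> y" using elim(2) by blast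
      moreover have "X u T \<omega> \<le> X (u + int n) T \<omega>" using monoD[OF elim(1), of u "u + int n"] by simp
      ultimately have "y < X (u + int n) T \<omega>" using u by simp
      then show "\<exists>g\<ge>1. consecutive (survivors X T \<omega>) y (y + g)"
        by (rule ex_consecutive[OF y, rotated]) (auto simp: survivors_def)
    qed
  qed
qed

text \<open>
  A survivor at \<open>y\<close> has almost surely exactly one next survivor, so its occupation is split
  according to the size of the gap that follows it.
\<close>

lemma occupation_has_sum:
  "((\<lambda>g. measure M {\<omega>\<in>space M. consecutive (survivors X T \<omega>) y (y + g)}) has_sum
    measure M {\<omega>\<in>space M. y \<in> survivors X T \<omega>}) {1..}"
proof -
  define C where "C g = {\<omega>\<in>space M. consecutive (survivors X T \<omega>) y (y + g)}" for g
  have "((\<lambda>g. measure M (C g)) has_sum measure M (\<Union>g. C g)) UNIV"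
  proof (rule M.has_sum_measure_disjoint_int)
    show "C g \<in> sets M" for g unfolding C_def by (rule sets_consecutive)
    show "disjoint_family C"
      by (auto simp: disjoint_family_on_def C_def dest: consecutive_unique)
  qed
  also have "measure M (\<Union>g. C g) = measure M {\<omega>\<in>space M. y \<in> survivors X T \<omega>}"
  proof (rule M.finite_measure_eq_AE)
    show "AE \<omega> in M. \<omega> \<in> (\<Union>g. C g) \<longleftrightarrow> \<omega> \<in> {\<omega>\<in>space M. y \<in> survivors X T \<omega>}"
      using AE_next_survivor[of y] AE_space
      by eventually_elim (use consecutive_left in \<open>unfold C_def, blast\<close>)
  qed (auto simp: C_def intro: sets_consecutive sets_occupied)
  finally have "((\<lambda>g. measure M (C g)) has_sum measure M {\<omega>\<in>space M. y \<in> survivors X T \<omega>}) UNIV" .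
  moreover have "measure M (C g) = 0" if "g \<notin> {1..}" for g
  proof -
    have "C g = {}" using that by (auto simp: C_def consecutive_def)
    then show ?thesis by simp
  qed
  ultimately show ?thesis
    unfolding C_def by (subst has_sum_cong_neutral[where T = UNIV]) auto
qed

lemma occupation_probability:
  "measure M {\<omega>\<in>space M. y \<in> survivors X T \<omega>} = P (2 * T) 0 + P (2 * T) 1"
proof -
  have "((\<lambda>g. measure M {\<omega>\<in>space M. consecutive (survivors X T \<omega>) y (y + g)}) has_sum
      (P (2 * T) 0 + P (2 * T) 1)) {1..}"
    by (rule has_sum_cong[THEN iffD2, OF _ gap_sum]) (simp add: gap_probability)
  with occupation_has_sum show ?thesis by (rule has_sum_unique)
qed

lemma emeasure_gap_intensity:
  "1 \<le> g \<Longrightarrow> emeasure (gap_intensity M X T y) {g} =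
    emeasure M {\<omega>\<in>space M. consecutive (survivors X T \<omega>) y (y + g)}"
  unfolding gap_intensity_def by (subst emeasure_point_measure_finite2) auto

lemma measure_gap_intensity:
  "1 \<le> g \<Longrightarrow> measure (gap_intensity M X T y) {g} = P (2 * T) (g - 1) - P (2 * T) (g + 1)"
  using emeasure_gap_intensity[of g y] gap_probability[of g y] by (simp add: measure_def)

lemma total_gap_intensity:
  "emeasure (gap_intensity M X T y) (space (gap_intensity M X T y)) =
    ennreal (P (2 * T) 0 + P (2 * T) 1)"
proof -
  define C where "C g = {\<omega>\<in>space M. consecutive (survivors X T \<omega>) y (y + g)}" for g
  have C_sets: "C g \<in> sets M" for g unfolding C_def by (rule sets_consecutive)
  have "emeasure (gap_intensity M X T y) (space (gap_intensity M X T y)) =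
      (\<integral>\<^sup>+g. emeasure M (C g) \<partial>count_space {1..})"
    unfolding gap_intensity_def C_def point_measure_def
    by (subst emeasure_density) (auto intro!: nn_integral_cong)
  also have "\<dots> = emeasure M (\<Union>g\<in>{1..}. C g)"
    using C_sets by (intro emeasure_UN_countable[symmetric])
      (auto simp: disjoint_family_on_def C_def dest: consecutive_unique)
  also have "\<dots> = emeasure M {\<omega>\<in>space M. y \<in> survivors X T \<omega>}"
  proof (rule emeasure_eq_AE)
    show "AE \<omega> in M. \<omega> \<in> (\<Union>g\<in>{1..}. C g) \<longleftrightarrow> \<omega> \<in> {\<omega>\<in>space M. y \<in> survivors X T \<omega>}"
      using AE_next_survivor[of y] AE_space
      by eventually_elim (use consecutive_left in \<open>unfold C_def, blast intro: atLeast_iff[THEN iffD2]\<close>)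
  qed (use C_sets sets_occupied in auto)
  finally show ?thesis by (simp add: M.emeasure_eq_measure occupation_probability)
qed

lemma
  shows prob_space_gap_law: "prob_space (gap_law M X T y)"
    and measure_gap_law: "1 \<le> g \<Longrightarrow> measure (gap_law M X T y) {g} =
    (P (2 * T) (g - 1) - P (2 * T) (g + 1)) / (P (2 * T) 0 + P (2 * T) 1)"
proof -
  define d where "d = P (2 * T) 0 + P (2 * T) 1"
  have d: "0 < d" using return_positive[OF T] P_nonneg[of "2 * T" 1] T by (simp add: d_def)
  have scale: "gap_law M X T y = scale_measure (ennreal (1 / d)) (gap_intensity M X T y)"
    unfolding gap_law_def Let_def total_gap_intensity using d
    by (simp add: d_def[symmetric] divide_ennreal flip: ennreal_1)
  show "prob_space (gap_law M X T y)"
    by (rule prob_spaceI)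
      (use d in \<open>simp add: scale space_scale_measure total_gap_intensity d_def[symmetric] flip: ennreal_mult\<close>)
  show "measure (gap_law M X T y) {g} =
      (P (2 * T) (g - 1) - P (2 * T) (g + 1)) / (P (2 * T) 0 + P (2 * T) 1)" if "1 \<le> g"
  proof -
    have "enn2real (ennreal (1 / d) * emeasure (gap_intensity M X T y) {g}) =
        (1 / d) * measure (gap_intensity M X T y) {g}"
      using d by (simp add: measure_def enn2real_mult)
    then show ?thesis
      using d that by (simp add: scale measure_def[of "scale_measure _ _"] measure_gap_intensity flip: d_def)
  qed
qed

end

end

theorem theorem1p2:
  fixes N :: "int \<Rightarrow> 'b measure" and Z :: "real \<Rightarrow> 'b \<Rightarrow> int"
    and P :: "real \<Rightarrow> int \<Rightarrow> real"
    and M :: "'a measure" and X :: "int \<Rightarrow> real \<Rightarrow> 'a \<Rightarrow> int"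
    and T :: real and y :: int
  assumes "skip_free_process N Z (\<lambda>s x y. P s (y - x))"
    and "\<And>s n. 0 \<le> s \<Longrightarrow> P s n = P s (- n)"
    and "coalescing_system N Z M X"
    and "0 < T"
  shows "(\<forall>g\<ge>1. measure (gap_intensity M X T y) {g} = P (2 * T) (g - 1) - P (2 * T) (g + 1)) \<and>
    ((\<lambda>g. measure (gap_intensity M X T y) {g}) has_sum (P (2 * T) 0 + P (2 * T) 1)) {1..} \<and>
    measure M {\<omega>\<in>space M. y \<in> survivors X T \<omega>} = P (2 * T) 0 + P (2 * T) 1 \<and>
    prob_space (gap_law M X T y) \<and>
    (\<forall>g\<ge>1. measure (gap_law M X T y) {g} =
       (P (2 * T) (g - 1) - P (2 * T) (g + 1)) / (P (2 * T) 0 + P (2 * T) 1))"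
proof -
  interpret symmetric_coalescing_flow N Z P M X
    by unfold_locales (use assms in blast)+
  have T: "0 \<le> T" using assms(4) by simp
  have "((\<lambda>g. measure (gap_intensity M X T y) {g}) has_sum (P (2 * T) 0 + P (2 * T) 1)) {1..}"
    by (rule has_sum_cong[THEN iffD2, OF _ gap_sum[OF T]]) (simp add: measure_gap_intensity[OF T])
  then show ?thesis
    using measure_gap_intensity[OF T] occupation_probability[OF T] prob_space_gap_law[OF T]
      measure_gap_law[OF T] by blast
qed

end
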